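(* Let $d\ge2$, let $U$ be a random variable, and let $V(S,U)$ be a stochastic cooperative game on $D=\{1,\dots,d\}$ with $\mathbb{E}_U|V(S,U)|<\infty$ for every $S\subseteq D$. Let $(z_i,u_i)_{i\ge1}$ be independent pairs of samples with $z_i\sim p$ (the normalized Shapley-kernel distribution) and $u_i\sim p(U)$, where $z_i$ and $u_i$ are independent of each other. Let $\beta^*=(\phi_1(V),\dots,\phi_d(V))$ be the vector of generalized Shapley values of $V$. Then: (i) the stochastic KernelSHAP estimator $\tilde\beta_n$ is consistent: $\lim_{n\to\infty}\tilde\beta_n=\beta^*$ almost surely; (ii) the stochastic unbiased KernelSHAP estimator $\tilde{\bar\beta}_n$ is unbiased and consistent: $\mathbb{E}[\tilde{\bar\beta}_n]=\beta^*$ for every $n\ge1$, and $\lim_{n\to\infty}\tilde{\bar\beta}_n=\beta^*$ almost surely.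
   Context: A stochastic cooperative game is a function $V(S,U)$ of a coalition $S\subseteq D=\{1,\dots,d\}$ and an exogenous random variable $U$, such that $V(\cdot,u)$ is a deterministic function of $S$ for each fixed $u$. Subsets are identified with $z\in\{0,1\}^d$ via $S=\{i:z_i=1\}$; $\mathbf 0,\mathbf 1$ are the all-zeros and all-ones vectors in $\mathbb{R}^d$. The generalized Shapley values are $$\phi_i(V)=\frac1d\sum_{S\subseteq D\setminus\{i\}}\binom{d-1}{|S|}^{-1}\mathbb{E}_U\big[V(S\cup\{i\},U)-V(S,U)\big].$$ Distribution $p$ on $\{0,1\}^d$: $p(z)\propto \dfrac{d-1}{\binom{d}{k}k(d-k)}$ with $k=\mathbf 1^Tz$ when $0<k<d$, and $p(z)=0$ when $k\in\{0,d\}$. $Z$ denotes a random vector with law $p$, and $A=\mathbb{E}[ZZ^T]$ (an invertible matrix). For an invertible matrix $M$ and $c\in\mathbb{R}^d$ put $$\mathcal B(M,c)=M^{-1}\Big(c-\mathbf 1\,\frac{\mathbf 1^TM^{-1}c-\mathbb{E}_U[V(\mathbf 1,U)]+\mathbb{E}_U[V(\mathbf 0,U)]}{\mathbf 1^TM^{-1}\mathbf 1}\Big).$$ Stochastic KernelSHAP: $\hat A_n=\frac1n\sum_{i=1}^nz_iz_i^T$, $\tilde b_n=\frac1n\sum_{i=1}^nz_i\big(V(z_i,u_i)-\mathbb{E}_U[V(\mathbf 0,U)]\big)$, $\tilde\beta_n=\mathcal B(\hat A_n,\tilde b_n)$ (when $\hat A_n$ is not invertible, set $\tilde\beta_n=0$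 by convention). Stochastic unbiased KernelSHAP: $\tilde{\bar b}_n=\frac1n\sum_{i=1}^nz_iV(z_i,u_i)-\mathbb{E}[Z]\,\mathbb{E}_U[V(\mathbf 0,U)]$, $\tilde{\bar\beta}_n=\mathcal B(A,\tilde{\bar b}_n)$. *)

theory Defs
  imports "HOL-Probability.Probability"
begin

text \<open>
  Players are the elements of a finite type, so \<open>d = CARD('d)\<close>. A vector \<open>z \<in> {0,1}\<^sup>d\<close> is
  identified with the coalition \<open>S = {i. z\<^sub>i = 1}\<close>; \<open>coalition_vec S\<close> is that 0/1 vector.
  The random variable \<open>U\<close> lives on a probability space \<open>P\<close>, and a game is a function
  \<open>V S u\<close>. On \<open>real ^ 'd\<close> the constant \<open>1\<close> is the all-ones vector.
\<close>

definition coalition_vec :: "'d::finite set \<Rightarrow> real ^ 'd" where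
  "coalition_vec S = (\<chi> i. if i \<in> S then 1 else 0)"

definition outer :: "real ^ 'd \<Rightarrow> real ^ 'd::finite ^ 'd" where
  "outer z = (columnvector z :: real ^ 1 ^ 'd) ** (rowvector z :: real ^ 'd ^ 1)"

definition game_mean :: "'w measure \<Rightarrow> ('w \<Rightarrow> 'u) \<Rightarrow> ('d set \<Rightarrow> 'u \<Rightarrow> real) \<Rightarrow> 'd set \<Rightarrow> real" where
  "game_mean P U V S = (\<integral>w. V S (U w) \<partial>P)"

definition shapley_values ::
    "'w measure \<Rightarrow> ('w \<Rightarrow> 'u) \<Rightarrow> ('d::finite set \<Rightarrow> 'u \<Rightarrow> real) \<Rightarrow> real ^ 'd" where
  "shapley_values P U V =
     (\<chi> i. 1 / real CARD('d) *
        (\<Sum>S \<in> Pow (UNIV - {i}).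
           inverse (real ((CARD('d) - 1) choose card S)) *
           (\<integral>w. V (insert i S) (U w) - V S (U w) \<partial>P)))"

definition kernel_weight :: "'d::finite set \<Rightarrow> real" where
  "kernel_weight S =
     (let d = CARD('d); k = card S
      in if 0 < k \<and> k < d
         then (real d - 1) / (real (d choose k) * real k * (real d - real k))
         else 0)"

text \<open>The law \<open>p\<close>: a probability measure as soon as \<open>CARD('d) \<ge> 2\<close>.\<close>

definition shapley_kernel :: "'d::finite set measure" where
  "shapley_kernel =
     point_measure UNIV (\<lambda>S. ennreal (kernel_weight S / (\<Sum>T\<in>(UNIV :: 'd set set). kernel_weight T)))"

definition kernel_mean :: "real ^ 'd::finite" where
  "kernel_mean = (\<integral>S. coalition_vec S \<partial>shapley_kernel)"

definition kernel_second_moment :: "real ^ 'd ^ 'd::finite" where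
  "kernel_second_moment = (\<integral>S. outer (coalition_vec S) \<partial>shapley_kernel)"

definition constrained_solution ::
    "'w measure \<Rightarrow> ('w \<Rightarrow> 'u) \<Rightarrow> ('d::finite set \<Rightarrow> 'u \<Rightarrow> real) \<Rightarrow>
     real ^ 'd ^ 'd \<Rightarrow> real ^ 'd \<Rightarrow> real ^ 'd" where
  "constrained_solution P U V M c =
     matrix_inv M *v
       (c - ((1 \<bullet> (matrix_inv M *v c) - game_mean P U V UNIV + game_mean P U V {})
              / (1 \<bullet> (matrix_inv M *v 1))) *\<^sub>R 1)"

text \<open>In the estimators, \<open>zs\<close> and \<open>us\<close> are sample sequences; the first \<open>n\<close> samples are
  those with indices \<open>1, \<dots>, n\<close>.\<close>

definition A_hat :: "(nat \<Rightarrow> 'd::finite set) \<Rightarrow> nat \<Rightarrow> real ^ 'd ^ 'd" where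
  "A_hat zs n = (1 / real n) *\<^sub>R (\<Sum>i=1..n. outer (coalition_vec (zs i)))"

definition b_tilde ::
    "'w measure \<Rightarrow> ('w \<Rightarrow> 'u) \<Rightarrow> ('d::finite set \<Rightarrow> 'u \<Rightarrow> real) \<Rightarrow>
     (nat \<Rightarrow> 'd set) \<Rightarrow> (nat \<Rightarrow> 'u) \<Rightarrow> nat \<Rightarrow> real ^ 'd" where
  "b_tilde P U V zs us n =
     (1 / real n) *\<^sub>R
       (\<Sum>i=1..n. (V (zs i) (us i) - game_mean P U V {}) *\<^sub>R coalition_vec (zs i))"

definition stochastic_kernelshap ::
    "'w measure \<Rightarrow> ('w \<Rightarrow> 'u) \<Rightarrow> ('d::finite set \<Rightarrow> 'u \<Rightarrow> real) \<Rightarrow>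
     (nat \<Rightarrow> 'd set) \<Rightarrow> (nat \<Rightarrow> 'u) \<Rightarrow> nat \<Rightarrow> real ^ 'd" where
  "stochastic_kernelshap P U V zs us n =
     (if invertible (A_hat zs n)
      then constrained_solution P U V (A_hat zs n) (b_tilde P U V zs us n)
      else 0)"

definition b_tilde_unbiased ::
    "'w measure \<Rightarrow> ('w \<Rightarrow> 'u) \<Rightarrow> ('d::finite set \<Rightarrow> 'u \<Rightarrow> real) \<Rightarrow>
     (nat \<Rightarrow> 'd set) \<Rightarrow> (nat \<Rightarrow> 'u) \<Rightarrow> nat \<Rightarrow> real ^ 'd" where
  "b_tilde_unbiased P U V zs us n =
     (1 / real n) *\<^sub>R (\<Sum>i=1..n. V (zs i) (us i) *\<^sub>R coalition_vec (zs i))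
     - game_mean P U V {} *\<^sub>R kernel_mean"

definition stochastic_unbiased_kernelshap ::
    "'w measure \<Rightarrow> ('w \<Rightarrow> 'u) \<Rightarrow> ('d::finite set \<Rightarrow> 'u \<Rightarrow> real) \<Rightarrow>
     (nat \<Rightarrow> 'd set) \<Rightarrow> (nat \<Rightarrow> 'u) \<Rightarrow> nat \<Rightarrow> real ^ 'd" where
  "stochastic_unbiased_kernelshap P U V zs us n =
     constrained_solution P U V kernel_second_moment (b_tilde_unbiased P U V zs us n)"

end

(*
  The estimators are continuous functions of sample means, so consistency reduces to the strong law
  of large numbers for integrable i.i.d. real variables and unbiasedness to linearity.

  Strong law, for nonnegative X: along k = ceiling (a^n) the deviation of the mean of k samples from
  E[X; X <= k] has probability at most E[X^2; X <= k] / (k e^2) + k P(X > k), by truncating all k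
  summands at the same level k. Since a^n is geometric, the sum over n is O(E X), and Borel-Cantelli
  applies; monotonicity of the partial sums fills the gaps as a tends to 1.

  Limit identification: write b for the limit of the vectors b_n. The Shapley value of player i is
  kappa b_i plus a term that depends on the game but not on i. For the dictator game of player j this
  gives kappa A = I - g 1 1^T without counting coalitions, and with efficiency
  A phi = b + lambda 1, 1^T phi = v(D) - v(0), the equations characterizing B(A, b).
*)
theory Submission
  imports Defs
begin

subsection \<open>The strong law of large numbers\<close>

text \<open>Only first moments of \<open>V\<close> are available, so a variance bound cannot be
  applied to the samples themselves. Truncation supplies second moments, but its cost k P(X > k)
  need not be summable over all k without a second moment; this forces the detour through sparse
  indices.

  The Shapley kernel is exactly what makes the limit work. In the value of player i, a nonempty
  proper coalition has one coefficient if i is a member and another if not, and the jump between the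
  two is a fixed multiple of its probability under p. The empty and the grand coalition have
  probability 0, yet each has the same coefficient for all players, so sampling never has to see
  them: their values enter through the centering and the constraint on the coordinate sum. Whatever
  is common to all players is a multiple of the all-ones vector and disappears into the multiplier
  lambda, which is why that term never has to be evaluated.\<close>

lemma sum_geometric_le:
  fixes r y :: real
  assumes "0 < r" "r < 1" "0 \<le> y"
  shows "(\<Sum>n<m. if r ^ n \<le> y then r ^ n else 0) \<le> y / (1 - r)"
  using \<open>0 \<le> y\<close>
\<comment> \<open>If the first term exceeds \<open>y\<close> it drops out, and shifting the index
  replaces \<open>y\<close> by \<open>y / r\<close>; hence \<open>y\<close> must vary.\<close>
proof (induction m arbitrary: y)
  case 0
  then show ?case using assms by simp
next
  case (Suc m)
  show ?case
  proof (cases "1 \<le> y")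
    case True
    have "(\<Sum>n<Suc m. if r ^ n \<le> y then r ^ n else 0) \<le> (\<Sum>n<Suc m. r ^ n)"
      using assms by (intro sum_mono) auto
    also have "\<dots> = (1 - r ^ Suc m) / (1 - r)"
      using assms by (simp add: sum_gp_strict del: sum.lessThan_Suc)
    also have "\<dots> \<le> y / (1 - r)"
      using assms True zero_le_power[of r "Suc m"] by (intro divide_right_mono) linarith+
    finally show ?thesis .
  next
    case False
    have "(\<Sum>n<Suc m. if r ^ n \<le> y then r ^ n else 0)
        = (\<Sum>n<m. if r ^ Suc n \<le> y then r ^ Suc n else 0)"
      using False by (simp add: sum.lessThan_Suc_shift del: power_Suc sum.lessThan_Suc)
    also have "\<dots> = r * (\<Sum>n<m. if r ^ n \<le> y / r then r ^ n else 0)"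
      using assms by (auto simp: sum_distrib_left field_simps intro!: sum.cong)
    also have "\<dots> \<le> r * ((y / r) / (1 - r))"
      using assms Suc by (intro mult_left_mono Suc.IH) auto
    also have "\<dots> = y / (1 - r)" using assms by simp
    finally show ?thesis .
  qed
qed

text \<open>A growing geometric sum is controlled by its largest term, so the induction peels off
  the top: once \<open>a ^ m < x\<close>, the whole sum is below
  \<open>a * a ^ m / (a - 1)\<close>.\<close>

lemma sum_geometric_less:
  fixes a x :: real
  assumes "1 < a" "0 \<le> x"
  shows "(\<Sum>n<m. if a ^ n < x then a ^ n else 0) \<le> a / (a - 1) * x"
proof (induction m)
  case 0
  then show ?case using assms by simp
next
  case (Suc m)
  show ?case
  proof (cases "a ^ m < x")
    case True
    have "(\<Sum>n<Suc m. if a ^ n < x then a ^ n else 0) \<le> (\<Sum>n<Suc m. a ^ n)"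
      using assms by (intro sum_mono) auto
    also have "\<dots> = (a * a ^ m - 1) / (a - 1)"
      using assms geometric_sum[of a "Suc m"] by (simp del: sum.lessThan_Suc)
    also have "\<dots> \<le> (a * x) / (a - 1)"
      using assms True mult_strict_left_mono[OF True, of a] by (intro divide_right_mono) linarith+
    finally show ?thesis by simp
  next
    case False
    then show ?thesis using Suc by simp
  qed
qed

lemma ceiling_power_bounds:
  fixes a :: real
  assumes "1 < a"
  shows "a ^ n \<le> real (nat \<lceil>a ^ n\<rceil>)" "real (nat \<lceil>a ^ n\<rceil>) \<le> 2 * a ^ n"
proof -
  have "1 \<le> a ^ n" using assms by simp
  then show "a ^ n \<le> real (nat \<lceil>a ^ n\<rceil>)" "real (nat \<lceil>a ^ n\<rceil>) \<le> 2 * a ^ n"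
    by linarith+
qed

lemma filterlim_ceiling_power:
  fixes a :: real
  assumes "1 < a"
  shows "filterlim (\<lambda>n. real (nat \<lceil>a ^ n\<rceil>)) at_top sequentially"
proof (rule filterlim_at_top_mono)
  show "filterlim (\<lambda>n. a ^ n) at_top sequentially"
    using assms
    by (intro filterlim_at_infinity_imp_filterlim_at_top filterlim_realpow_sequentially_gt1) auto
qed (use ceiling_power_bounds(1)[OF assms] in simp)

text \<open>The summand is the integrand of the deviation bound at level \<open>k n\<close>, so this
  pointwise estimate only has to be integrated. Levels above \<open>x\<close> form a decaying
  geometric tail of \<open>x\<^sup>2 / k n\<close> whose first term is of order \<open>x\<close>;
  levels below \<open>x\<close> form a growing geometric sum whose last term is of order
  \<open>x\<close>.\<close>

lemma sum_truncation_le: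
  fixes a x e :: real
  assumes "1 < a" "0 \<le> x" "0 < e"
  defines "k \<equiv> \<lambda>n. real (nat \<lceil>a ^ n\<rceil>)"
  shows "(\<Sum>n<m. if x \<le> k n then x\<^sup>2 / (k n * e\<^sup>2) else k n)
           \<le> 2 * a / (a - 1) * (1 + 1 / e\<^sup>2) * x"
proof (cases "x = 0")
  case True
  then show ?thesis by (auto simp: k_def intro!: sum_nonpos)
next
  case False
  with assms have x: "0 < x" by simp
  define r where "r = 1 / a"
  have r: "0 < r" "r < 1" using assms by (auto simp: r_def)
  have kb: "a ^ n \<le> k n" "k n \<le> 2 * a ^ n" for n
    using ceiling_power_bounds[OF assms(1)] by (auto simp: k_def)
  have an: "0 < a ^ n" for n using assms by simp
  have kp: "0 < k n" for n using kb(1)[of n] an[of n] by linarith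
  \<comment> \<open>Rounding costs a factor 2 in each case: \<open>k n \<le> 2 * a ^ n\<close> turns
    \<open>x \<le> k n\<close> into \<open>r ^ n \<le> 2 / x\<close>, and it bounds the level itself
    when \<open>x\<close> is larger.\<close>
  have "(if x \<le> k n then x\<^sup>2 / (k n * e\<^sup>2) else k n)
      \<le> x\<^sup>2 / e\<^sup>2 * (if r ^ n \<le> 2 / x then r ^ n else 0) + 2 * (if a ^ n < x then a ^ n else 0)" for n
  proof (cases "x \<le> k n")
    case True
    then have "x \<le> 2 * a ^ n" using kb(2)[of n] by linarith
    then have "r ^ n \<le> 2 / x" using x an[of n] by (simp add: r_def field_simps)
    moreover have "x\<^sup>2 / e\<^sup>2 * (1 / k n) \<le> x\<^sup>2 / e\<^sup>2 * r ^ n"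
      using kb(1)[of n] an[of n] assms(3)
      by (intro mult_left_mono) (auto simp: r_def divide_simps)
    then have "x\<^sup>2 / (k n * e\<^sup>2) \<le> x\<^sup>2 / e\<^sup>2 * r ^ n" by (simp add: mult.commute)
    ultimately show ?thesis using True an[of n] by (simp add: add_increasing2)
  next
    case F: False
    then have "a ^ n < x" using kb(1)[of n] by linarith
    then show ?thesis using F kb(2)[of n] r by (simp add: add_increasing)
  qed
  then have "(\<Sum>n<m. if x \<le> k n then x\<^sup>2 / (k n * e\<^sup>2) else k n)
      \<le> x\<^sup>2 / e\<^sup>2 * (\<Sum>n<m. if r ^ n \<le> 2 / x then r ^ n else 0)
        + 2 * (\<Sum>n<m. if a ^ n < x then a ^ n else 0)"
    by (simp add: sum_distrib_left flip: sum.distrib) (intro sum_mono, simp)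
  also have "\<dots> \<le> x\<^sup>2 / e\<^sup>2 * ((2 / x) / (1 - r)) + 2 * (a / (a - 1) * x)"
    using r x assms
    by (intro add_mono mult_left_mono sum_geometric_le sum_geometric_less) auto
  also have "(2 / x) / (1 - r) = (2 * a / (a - 1)) / x"
    using assms x by (simp add: r_def field_simps)
  also have "x\<^sup>2 / e\<^sup>2 * ((2 * a / (a - 1)) / x) + 2 * (a / (a - 1) * x)
      = 2 * a / (a - 1) * (1 + 1 / e\<^sup>2) * x"
    using x by (simp add: power2_eq_square distrib_left distrib_right add_divide_distrib mult_ac add_ac)
  finally show ?thesis .
qed

section \<open>Deviation estimates from truncation\<close>

lemma (in prob_space) variance_sum_indep_vars:
  fixes X :: "'i \<Rightarrow> 'a \<Rightarrow> real"
  assumes "finite I" "indep_vars (\<lambda>_. borel) X I"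
    and "\<And>i. i \<in> I \<Longrightarrow> integrable M (\<lambda>x. (X i x)\<^sup>2)"
  shows "integrable M (\<lambda>x. (\<Sum>i\<in>I. X i x)\<^sup>2)"
    and "variance (\<lambda>x. \<Sum>i\<in>I. X i x) = (\<Sum>i\<in>I. variance (X i))"
proof -
  \<comment> \<open>Both claims share one induction: the variance formula for the enlarged sum
    requires square integrability of the partial sum.\<close>
  have "integrable M (\<lambda>x. (\<Sum>i\<in>I. X i x)\<^sup>2) \<and>
      variance (\<lambda>x. \<Sum>i\<in>I. X i x) = (\<Sum>i\<in>I. variance (X i))"
    using assms
  proof (induction I rule: finite_induct)
    case empty
    then show ?case by simp
  next
    case (insert j I)
    let ?S = "\<lambda>x. \<Sum>i\<in>I. X i x"
    have meas: "random_variable borel (X i)" if "i \<in> insert j I" for i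
      using insert.prems(1) that by (auto simp: indep_vars_def)
    have "indep_vars (\<lambda>_. borel) X I"
      by (rule indep_vars_subset[OF insert.prems(1)]) (rule subset_insertI)
    then have IH: "integrable M (\<lambda>x. (?S x)\<^sup>2) \<and> variance ?S = (\<Sum>i\<in>I. variance (X i))"
      by (rule insert.IH) (rule insert.prems(2), rule insertI2)
    note IH = conjunct1[OF IH] conjunct2[OF IH]
    have S2: "integrable M ?S"
      by (rule square_integrable_imp_integrable[OF borel_measurable_sum IH(1)]) (rule meas, rule insertI2)
    have X2: "integrable M (\<lambda>x. (X j x)\<^sup>2)" using insert.prems(2) by blast
    have X1: "integrable M (X j)"
      by (rule square_integrable_imp_integrable[OF meas X2]) simp
    have ind: "indep_var borel (X j) borel ?S"
      using insert.hyps insert.prems(1) by (rule indep_vars_sum)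
    note XS = indep_var_integrable[OF ind X1 S2] indep_var_lebesgue_integral[OF ind X1 S2]
    have sq: "(X j x + ?S x)\<^sup>2 = (X j x)\<^sup>2 + 2 * (X j x * ?S x) + (?S x)\<^sup>2" for x
      by (simp add: power2_eq_square algebra_simps)
    have int: "integrable M (\<lambda>x. (X j x + ?S x)\<^sup>2)"
      unfolding sq using X2 XS IH(1) by (intro Bochner_Integration.integrable_add) auto
    have E2: "expectation (\<lambda>x. (X j x + ?S x)\<^sup>2) = expectation (\<lambda>x. (X j x)\<^sup>2)
        + 2 * (expectation (X j) * expectation ?S) + expectation (\<lambda>x. (?S x)\<^sup>2)"
      unfolding sq using X2 XS IH(1) by simp
    have "variance (\<lambda>x. X j x + ?S x) = variance (X j) + variance ?S"
      unfolding variance_eq[OF X1 X2] variance_eq[OF S2 IH(1)]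
        variance_eq[OF Bochner_Integration.integrable_add[OF X1 S2] int] E2
      unfolding Bochner_Integration.integral_add[OF X1 S2]
      by (simp add: power2_sum)
    then show ?case using int IH insert.hyps by simp
  qed
  then show "integrable M (\<lambda>x. (\<Sum>i\<in>I. X i x)\<^sup>2)"
    and "variance (\<lambda>x. \<Sum>i\<in>I. X i x) = (\<Sum>i\<in>I. variance (X i))" by blast+
qed

text \<open>Unless some \<open>X i\<close> exceeds \<open>k\<close>, truncation changes nothing, so
  Chebyshev for the truncated sum and a union bound cover all cases. The two bounds integrate over
  the complementary events \<open>X 1 \<le> k\<close> and \<open>X 1 > k\<close>, which is why they
  merge into a single \<open>if\<close>.\<close>

lemma (in prob_space) deviation_from_truncated_mean:
  fixes X :: "nat \<Rightarrow> 'a \<Rightarrow> real"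
  assumes ind: "indep_vars (\<lambda>_. borel) X {1..k}" and k: "0 < k" and e: "0 < e"
    and dist: "\<And>i. i \<in> {1..k} \<Longrightarrow> distr M borel (X i) = distr M borel (X 1)"
    and nn: "\<And>i x. i \<in> {1..k} \<Longrightarrow> x \<in> space M \<Longrightarrow> 0 \<le> X i x"
  shows "prob {x \<in> space M. e \<le> \<bar>(\<Sum>i=1..k. X i x) / real k
             - expectation (\<lambda>x. if X 1 x \<le> real k then X 1 x else 0)\<bar>}
       \<le> expectation (\<lambda>x. if X 1 x \<le> real k then (X 1 x)\<^sup>2 / (real k * e\<^sup>2) else real k)"
proof -
  define g where "g = (\<lambda>y::real. if y \<le> real k then y else 0)"
  have gm [measurable]: "g \<in> borel_measurable borel" unfolding g_def by measurable
  have meas: "random_variable borel (X i)" if "i \<in> {1..k}" for i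
    using ind that by (auto simp: indep_vars_def)
  have meas1 [measurable]: "random_variable borel (X 1)" using meas k by simp
  have trans: "expectation (\<lambda>x. h (X i x)) = expectation (\<lambda>x. h (X 1 x))"
    if "i \<in> {1..k}" "h \<in> borel_measurable borel" for h :: "real \<Rightarrow> real" and i
    using that meas dist[OF that(1)] integral_distr[of "X i" M borel h]
      integral_distr[of "X 1" M borel h] meas1 by simp
  have gb: "0 \<le> g (X i x)" "g (X i x) \<le> real k" if "i \<in> {1..k}" "x \<in> space M" for i x
    using nn[OF that] by (auto simp: g_def)
  have gi: "integrable M (\<lambda>x. g (X i x))" "integrable M (\<lambda>x. (g (X i x))\<^sup>2)" if "i \<in> {1..k}" for i
  proof -
    note [measurable] = meas[OF that]
    show "integrable M (\<lambda>x. g (X i x))"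
      using gb[OF that] by (intro integrable_const_bound[where B="real k"]) (auto intro!: AE_I2)
    show "integrable M (\<lambda>x. (g (X i x))\<^sup>2)"
      using gb[OF that] by (intro integrable_const_bound[where B="(real k)\<^sup>2"])
        (auto intro!: AE_I2 power_mono)
  qed
  have k1: "1 \<in> {1..k}" using k by simp
  let ?T = "\<lambda>x. \<Sum>i=1..k. g (X i x)"
  let ?m = "expectation (\<lambda>x. g (X 1 x))"
  have indg: "indep_vars (\<lambda>_. borel) (\<lambda>i x. g (X i x)) {1..k}"
    by (rule indep_vars_compose2[OF ind]) simp
  have Tm: "random_variable borel ?T" using meas by (intro borel_measurable_sum) measurable
  have ET: "expectation ?T = k * ?m"
  proof -
    have "expectation ?T = (\<Sum>i=1..k. expectation (\<lambda>x. g (X i x)))"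
      using gi by (intro Bochner_Integration.integral_sum) simp
    also have "\<dots> = (\<Sum>i=1..k. ?m)" using trans gm by (intro sum.cong) blast+
    finally show ?thesis by simp
  qed
  have "variance ?T = (\<Sum>i=1..k. variance (\<lambda>x. g (X i x)))"
    using gi by (intro variance_sum_indep_vars[OF _ indg]) auto
  also have "\<dots> \<le> (\<Sum>i=1..k. expectation (\<lambda>x. (g (X 1 x))\<^sup>2))"
  proof (rule sum_mono)
    fix i assume i: "i \<in> {1..k}"
    have "expectation (\<lambda>x. (g (X i x))\<^sup>2) = expectation (\<lambda>x. (g (X 1 x))\<^sup>2)"
      using i by (rule trans) measurable
    then show "variance (\<lambda>x. g (X i x)) \<le> expectation (\<lambda>x. (g (X 1 x))\<^sup>2)"
      using gi[OF i] by (subst variance_eq) simp_all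
  qed
  finally have var: "variance ?T \<le> k * expectation (\<lambda>x. (g (X 1 x))\<^sup>2)" by simp
  have "prob {x \<in> space M. e * k \<le> \<bar>?T x - expectation ?T\<bar>} \<le> variance ?T / (e * k)\<^sup>2"
    using e k gi Tm by (intro Chebyshev_inequality variance_sum_indep_vars(1)[OF _ indg]) auto
  also have "\<dots> \<le> k * expectation (\<lambda>x. (g (X 1 x))\<^sup>2) / (e * k)\<^sup>2"
    using var by (intro divide_right_mono) auto
  also have "\<dots> = expectation (\<lambda>x. (g (X 1 x))\<^sup>2 / (real k * e\<^sup>2))"
    using k by (simp add: power2_eq_square field_simps)
  finally have A: "prob {x \<in> space M. e * k \<le> \<bar>?T x - expectation ?T\<bar>}
      \<le> expectation (\<lambda>x. (g (X 1 x))\<^sup>2 / (real k * e\<^sup>2))" .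
  have Am: "{x \<in> space M. real k < X i x} \<in> events" if "i \<in> {1..k}" for i
    using meas[OF that] by measurable
  have Um: "(\<Union>i\<in>{1..k}. {x \<in> space M. real k < X i x}) \<in> events"
    by (rule sets.finite_UN[OF _ Am]) simp_all
  have Dm: "{x \<in> space M. e * k \<le> \<bar>?T x - expectation ?T\<bar>} \<in> events"
    using Tm by measurable
  have same: "prob {x \<in> space M. real k < X i x} = prob {x \<in> space M. real k < X 1 x}" if "i \<in> {1..k}" for i
  proof -
    note [measurable] = meas[OF that]
    have "measure (distr M borel (X i)) {real k<..} = measure (distr M borel (X 1)) {real k<..}"
      using dist[OF that] by simp
    then show ?thesis
      using measure_distr[OF meas[OF that], of "{real k<..}"] measure_distr[OF meas1, of "{real k<..}"]
      by (simp add: vimage_def Int_def conj_commute)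
  qed
  have "prob (\<Union>i\<in>{1..k}. {x \<in> space M. real k < X i x})
      \<le> (\<Sum>i=1..k. prob {x \<in> space M. real k < X i x})"
    by (rule finite_measure_subadditive_finite) (use Am in auto)
  also have "\<dots> = (\<Sum>i=1..k. prob {x \<in> space M. real k < X 1 x})"
    by (rule sum.cong) (auto simp only: same)
  also have "\<dots> = k * prob {x \<in> space M. real k < X 1 x}" by simp
  also have "\<dots> = expectation (\<lambda>x. real k * indicator {x \<in> space M. real k < X 1 x} x)"
    using Int_absorb2[OF sets.sets_into_space[OF Am[OF k1]]] by simp
  finally have B: "prob (\<Union>i\<in>{1..k}. {x \<in> space M. real k < X i x})
      \<le> expectation (\<lambda>x. real k * indicator {x \<in> space M. real k < X 1 x} x)" .
  have sub: "{x \<in> space M. e \<le> \<bar>(\<Sum>i=1..k. X i x) / real k - ?m\<bar>}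
      \<subseteq> {x \<in> space M. e * k \<le> \<bar>?T x - expectation ?T\<bar>}
        \<union> (\<Union>i\<in>{1..k}. {x \<in> space M. real k < X i x})"
  proof safe
    fix x assume x: "x \<in> space M" "e \<le> \<bar>(\<Sum>i=1..k. X i x) / real k - ?m\<bar>"
      "x \<notin> (\<Union>i\<in>{1..k}. {x \<in> space M. real k < X i x})"
    then have "X i x = g (X i x)" if "i \<in> {1..k}" for i using that by (force simp: g_def)
    then have S: "(\<Sum>i=1..k. X i x) = ?T x" by (intro sum.cong) auto
    have "e * k \<le> \<bar>(\<Sum>i=1..k. X i x) / real k - ?m\<bar> * k"
      using x(2) by (intro mult_right_mono) auto
    also have "\<dots> = \<bar>((\<Sum>i=1..k. X i x) / real k - ?m) * k\<bar>"
      by (simp add: abs_mult)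
    also have "((\<Sum>i=1..k. X i x) / real k - ?m) * k = ?T x - expectation ?T"
      unfolding ET S using k by (simp add: field_simps)
    finally show "e * k \<le> \<bar>?T x - expectation ?T\<bar>" .
  qed
  have "prob {x \<in> space M. e \<le> \<bar>(\<Sum>i=1..k. X i x) / real k - ?m\<bar>}
      \<le> prob ({x \<in> space M. e * k \<le> \<bar>?T x - expectation ?T\<bar>}
        \<union> (\<Union>i\<in>{1..k}. {x \<in> space M. real k < X i x}))"
    by (rule finite_measure_mono[OF sub sets.Un[OF Dm Um]])
  also have "\<dots> \<le> prob {x \<in> space M. e * k \<le> \<bar>?T x - expectation ?T\<bar>}
        + prob (\<Union>i\<in>{1..k}. {x \<in> space M. real k < X i x})"
    by (rule measure_Un_le[OF Dm Um])
  also have "\<dots> \<le> expectation (\<lambda>x. (g (X 1 x))\<^sup>2 / (real k * e\<^sup>2))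
      + expectation (\<lambda>x. real k * indicator {x \<in> space M. real k < X 1 x} x)"
    using A B by (rule add_mono)
  also have "\<dots> = expectation (\<lambda>x. (g (X 1 x))\<^sup>2 / (real k * e\<^sup>2)
      + real k * indicator {x \<in> space M. real k < X 1 x} x)"
    using gi[OF k1] Am[OF k1]
    by (intro Bochner_Integration.integral_add[symmetric] integrable_divide_zero
        integrable_mult_right integrable_real_indicator) (auto simp: emeasure_eq_measure)
  also have "\<dots> = expectation (\<lambda>x. if X 1 x \<le> real k then (X 1 x)\<^sup>2 / (real k * e\<^sup>2) else real k)"
    by (intro Bochner_Integration.integral_cong) (auto simp: g_def)
  finally show ?thesis unfolding g_def .
qed

section \<open>Passage from geometric index sequences to all indices\<close>

lemma ceiling_power_ratio_tendsto:
  fixes a :: real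
  assumes "1 < a"
  shows "(\<lambda>n. real (nat \<lceil>a ^ Suc n\<rceil>) / real (nat \<lceil>a ^ n\<rceil>)) \<longlonglongrightarrow> a"
proof -
  define q where "q n = real (nat \<lceil>a ^ n\<rceil>) / a ^ n" for n
  have an: "1 \<le> a ^ n" for n using assms by simp
  \<comment> \<open>Rounding up adds less than 1 to \<open>a ^ n\<close>, a relative error of at
    most \<open>(1 / a) ^ n\<close>.\<close>
  have "q \<longlonglongrightarrow> 1"
  proof (rule tendsto_sandwich)
    show "\<forall>\<^sub>F n in sequentially. 1 \<le> q n"
      using ceiling_power_bounds(1)[OF assms] assms by (simp add: q_def)
    show "\<forall>\<^sub>F n in sequentially. q n \<le> 1 + (1 / a) ^ n"
    proof (intro always_eventually allI)
      fix n
      have "real (nat \<lceil>a ^ n\<rceil>) \<le> a ^ n + 1" using an[of n] by linarith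
      then show "q n \<le> 1 + (1 / a) ^ n"
        using assms by (simp add: q_def divide_simps)
    qed
    have "(\<lambda>n. (1 / a) ^ n) \<longlonglongrightarrow> 0" using assms by (intro LIMSEQ_power_zero) simp
    from tendsto_add[OF tendsto_const this, of 1]
    show "(\<lambda>n. 1 + (1 / a) ^ n) \<longlonglongrightarrow> 1" by simp
  qed simp
  then have "(\<lambda>n. a * (q (Suc n) / q n)) \<longlonglongrightarrow> a * (1 / 1)"
    by (intro tendsto_intros LIMSEQ_Suc) simp_all
  moreover have "a * (q (Suc n) / q n) = real (nat \<lceil>a ^ Suc n\<rceil>) / real (nat \<lceil>a ^ n\<rceil>)" for n
    using assms an[of n] by (simp add: q_def)
  ultimately show ?thesis by simp
qed

text \<open>For \<open>k n \<le> N < k (Suc n)\<close> the mean at \<open>N\<close> lies between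
  \<open>s (k n) / k (Suc n)\<close> and \<open>s (k (Suc n)) / k n\<close>, whose limits are
  \<open>\<mu> / a\<close> and \<open>\<mu> * a\<close>. The ratios \<open>1 + 1 / Suc m\<close>
  form a countable family tending to 1, so in the application only countably many null sets have to
  be discarded.\<close>

lemma mean_tendsto_from_geometric_subsequences:
  fixes s :: "nat \<Rightarrow> real"
  assumes mono: "mono s" and nn: "\<And>n. 0 \<le> s n"
    and lim: "\<And>m::nat. (\<lambda>n. s (nat \<lceil>(1 + 1 / real (Suc m)) ^ n\<rceil>)
        / real (nat \<lceil>(1 + 1 / real (Suc m)) ^ n\<rceil>)) \<longlonglongrightarrow> \<mu>"
  shows "(\<lambda>n. s n / real n) \<longlonglongrightarrow> \<mu>"
proof -
  define a where "a m = 1 + 1 / real (Suc m)" for m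
  define k where "k m n = nat \<lceil>a m ^ n\<rceil>" for m n
  have a1: "1 < a m" for m by (simp add: a_def)
  have alim: "a \<longlonglongrightarrow> 1"
    using tendsto_add[OF tendsto_const[of 1] LIMSEQ_inverse_real_of_nat]
    by (simp add: a_def[abs_def] inverse_eq_divide)
  have kpos: "0 < k m n" for m n
    using ceiling_power_bounds(1)[OF a1, of m n] one_le_power[of "a m" n] a1[of m]
    by (simp add: k_def)
  have klim: "filterlim (k m) at_top sequentially" for m
  proof -
    have "filterlim (\<lambda>n. real (k m n)) at_top sequentially"
      unfolding k_def by (rule filterlim_ceiling_power[OF a1])
    then show ?thesis by (simp add: filterlim_sequentially_iff_filterlim_real)
  qed
  have bracket: "\<exists>n\<ge>n0. k m n \<le> N \<and> N < k m (Suc n)" if "k m n0 \<le> N" for m n0 N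
  proof -
    have "\<forall>\<^sub>F n in sequentially. Suc N \<le> k m n"
      using klim[of m] by (simp add: filterlim_at_top)
    then obtain n1 where "\<forall>n\<ge>n1. Suc N \<le> k m n" by (auto simp: eventually_sequentially)
    then have ex: "\<exists>j. n0 \<le> j \<and> N < k m j" by (intro exI[of _ "max n0 n1"]) (auto simp: Suc_le_eq)
    \<comment> \<open>Since \<open>k m n0 \<le> N\<close>, this \<open>j\<close> exceeds
      \<open>n0\<close>; by minimality its predecessor is the bracketing index.\<close>
    define j where "j = (LEAST j. n0 \<le> j \<and> N < k m j)"
    have j: "n0 \<le> j" "N < k m j" using LeastI_ex[OF ex] by (auto simp: j_def)
    with that have "n0 < j" by (metis le_neq_implies_less not_le)
    then obtain n where n: "j = Suc n" "n0 \<le> n" by (cases j) auto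
    then have "n < (LEAST j. n0 \<le> j \<and> N < k m j)" by (simp add: j_def)
    then have "\<not> (n0 \<le> n \<and> N < k m n)" by (rule not_less_Least)
    then show ?thesis using n j by (auto simp: not_less)
  qed
  have lim': "(\<lambda>n. s (k m n) / real (k m n)) \<longlonglongrightarrow> \<mu>" for m
    using lim[of m] by (simp add: k_def a_def)
  have ratio: "(\<lambda>n. real (k m (Suc n)) / real (k m n)) \<longlonglongrightarrow> a m" for m
    unfolding k_def by (rule ceiling_power_ratio_tendsto[OF a1])
  have upper: "(\<lambda>n. s (k m (Suc n)) / real (k m n)) \<longlonglongrightarrow> \<mu> * a m" for m
    using tendsto_mult[OF LIMSEQ_Suc[OF lim'[of m]] ratio[of m]] kpos
    by (simp add: less_imp_neq[symmetric])
  have lower: "(\<lambda>n. s (k m n) / real (k m (Suc n))) \<longlonglongrightarrow> \<mu> / a m" for m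
    using tendsto_divide[OF lim'[of m] ratio[of m]] kpos a1[of m]
    by (simp add: less_imp_neq[symmetric])
  show ?thesis
  proof (rule order_tendstoI)
    fix c assume c: "c < \<mu>"
    have "(\<lambda>m. \<mu> / a m) \<longlonglongrightarrow> \<mu> / 1" by (intro tendsto_intros alim) simp
    then have "\<forall>\<^sub>F m in sequentially. c < \<mu> / a m" using c by (intro order_tendstoD(1)) simp_all
    then obtain m where m: "c < \<mu> / a m" by (auto simp: eventually_sequentially)
    obtain n0 where n0: "\<And>n. n \<ge> n0 \<Longrightarrow> c < s (k m n) / real (k m (Suc n))"
      using order_tendstoD(1)[OF lower m] by (auto simp: eventually_sequentially)
    have "c < s N / real N" if N: "k m n0 \<le> N" for N
    proof -
      obtain n where n: "n \<ge> n0" "k m n \<le> N" "N < k m (Suc n)" using bracket[OF N] by auto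
      have "c < s (k m n) / real (k m (Suc n))" using n0 n by auto
      also have "\<dots> \<le> s N / real N"
        using n kpos[of m n] monoD[OF mono n(2)] nn by (intro frac_le) auto
      finally show ?thesis .
    qed
    then show "\<forall>\<^sub>F N in sequentially. c < s N / real N" by (auto simp: eventually_sequentially)
  next
    fix c assume c: "\<mu> < c"
    have "(\<lambda>m. \<mu> * a m) \<longlonglongrightarrow> \<mu> * 1" by (intro tendsto_intros alim)
    then have "\<forall>\<^sub>F m in sequentially. \<mu> * a m < c" using c by (intro order_tendstoD(2)) simp_all
    then obtain m where m: "\<mu> * a m < c" by (auto simp: eventually_sequentially)
    obtain n0 where n0: "\<And>n. n \<ge> n0 \<Longrightarrow> s (k m (Suc n)) / real (k m n) < c"
      using order_tendstoD(2)[OF upper m] by (auto simp: eventually_sequentially)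
    have "s N / real N < c" if N: "k m n0 \<le> N" for N
    proof -
      obtain n where n: "n \<ge> n0" "k m n \<le> N" "N < k m (Suc n)" using bracket[OF N] by auto
      have "s N / real N \<le> s (k m (Suc n)) / real (k m n)"
        using n kpos[of m n] monoD[OF mono less_imp_le[OF n(3)]] nn by (intro frac_le) auto
      also have "\<dots> < c" using n0 n by auto
      finally show ?thesis .
    qed
    then show "\<forall>\<^sub>F N in sequentially. s N / real N < c" by (auto simp: eventually_sequentially)
  qed
qed

lemma (in prob_space) strong_law_nonneg_geometric_subsequence:
  fixes X :: "nat \<Rightarrow> 'a \<Rightarrow> real" and a :: real
  assumes ind: "indep_vars (\<lambda>_. borel) X {1..}"
    and dist: "\<And>i. 1 \<le> i \<Longrightarrow> distr M borel (X i) = distr M borel (X 1)"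
    and int: "integrable M (X 1)"
    and nn: "\<And>i x. 1 \<le> i \<Longrightarrow> x \<in> space M \<Longrightarrow> 0 \<le> X i x" and a: "1 < a"
  defines "k \<equiv> \<lambda>n. nat \<lceil>a ^ n\<rceil>"
  shows "AE x in M. (\<lambda>n. (\<Sum>i=1..k n. X i x) / real (k n)) \<longlonglongrightarrow> expectation (X 1)"
proof -
  define m where "m n = expectation (\<lambda>x. if X 1 x \<le> real (k n) then X 1 x else 0)" for n
  define F where "F e n = {x \<in> space M. e \<le> \<bar>(\<Sum>i=1..k n. X i x) / real (k n) - m n\<bar>}" for e n
  have meas: "random_variable borel (X i)" if "1 \<le> i" for i
    using ind that by (auto simp: indep_vars_def)
  have m1 [measurable]: "random_variable borel (X 1)" using meas by simp
  have kb: "a ^ n \<le> real (k n)" "1 \<le> a ^ n" for n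
    using ceiling_power_bounds[OF a] a by (auto simp: k_def)
  have kpos: "0 < k n" for n using kb(1)[of n] kb(2)[of n] by simp
  have Fm: "F e n \<in> events" for e n
  proof -
    have [measurable]: "random_variable borel (\<lambda>x. \<Sum>i=1..k n. X i x)"
      by (intro borel_measurable_sum meas) simp
    show ?thesis unfolding F_def by measurable
  qed
  \<comment> \<open>Centering at the truncated mean, which varies with \<open>n\<close>, is
    therefore harmless in the limit.\<close>
  have mlim: "m \<longlonglongrightarrow> expectation (X 1)"
    unfolding m_def
  proof (rule integral_dominated_convergence[where w="X 1"])
    have "filterlim (\<lambda>n. real (k n)) at_top sequentially"
      unfolding k_def by (rule filterlim_ceiling_power[OF a])
    then have ev: "\<forall>\<^sub>F n in sequentially. y \<le> real (k n)" for y
      by (simp add: filterlim_at_top)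
    show "AE x in M. (\<lambda>n. if X 1 x \<le> real (k n) then X 1 x else 0) \<longlonglongrightarrow> X 1 x"
      by (intro AE_I2 tendsto_eventually eventually_mono[OF ev]) simp
  qed (use int nn in auto)
  have summ: "summable (\<lambda>n. prob (F e n))" if e: "0 < e" for e
  proof (rule summableI_nonneg_bounded)
    fix N
    define h where "h n = (\<lambda>x. if X 1 x \<le> real (k n) then (X 1 x)\<^sup>2 / (real (k n) * e\<^sup>2) else real (k n))" for n
    have hi: "integrable M (h n)" for n
    proof (rule integrable_const_bound[where B="real (k n) / e\<^sup>2 + real (k n)"])
      show "AE x in M. norm (h n x) \<le> real (k n) / e\<^sup>2 + real (k n)"
      proof (rule AE_I2)
        fix x assume x: "x \<in> space M"
        show "norm (h n x) \<le> real (k n) / e\<^sup>2 + real (k n)"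
        proof (cases "X 1 x \<le> real (k n)")
          case True
          then have "(X 1 x)\<^sup>2 \<le> (real (k n))\<^sup>2" using nn x by (intro power_mono) auto
          then have "(X 1 x)\<^sup>2 / (real (k n) * e\<^sup>2) \<le> (real (k n))\<^sup>2 / (real (k n) * e\<^sup>2)"
            using e by (intro divide_right_mono) auto
          also have "\<dots> = real (k n) / e\<^sup>2" by (simp add: power2_eq_square)
          finally show ?thesis using True by (simp add: h_def)
        qed (simp add: h_def)
      qed
      show "random_variable borel (h n)" unfolding h_def by measurable
    qed
    have "(\<Sum>n<N. prob (F e n)) \<le> (\<Sum>n<N. expectation (h n))"
    proof (rule sum_mono)
      fix n
      show "prob (F e n) \<le> expectation (h n)"
        unfolding F_def m_def h_def
      proof (rule deviation_from_truncated_mean[OF _ kpos e])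
        show "indep_vars (\<lambda>_. borel) X {1..k n}" by (rule indep_vars_subset[OF ind]) auto
        show "distr M borel (X i) = distr M borel (X 1)" if "i \<in> {1..k n}" for i
          using that by (intro dist) simp
      qed (simp add: nn)
    qed
    \<comment> \<open>Moving the sum inside the expectation lets the pointwise truncation estimate
      act, with a constant independent of \<open>N\<close>.\<close>
    also have "\<dots> = expectation (\<lambda>x. \<Sum>n<N. h n x)" using hi by simp
    also have "\<dots> \<le> expectation (\<lambda>x. 2 * a / (a - 1) * (1 + 1 / e\<^sup>2) * X 1 x)"
    proof (rule integral_mono)
      show "(\<Sum>n<N. h n x) \<le> 2 * a / (a - 1) * (1 + 1 / e\<^sup>2) * X 1 x" if "x \<in> space M" for x
        unfolding h_def k_def using nn[OF _ that] by (intro sum_truncation_le a e) simp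
    qed (use hi int in auto)
    also have "\<dots> = 2 * a / (a - 1) * (1 + 1 / e\<^sup>2) * expectation (X 1)" by simp
    finally show "(\<Sum>n<N. prob (F e n)) \<le> 2 * a / (a - 1) * (1 + 1 / e\<^sup>2) * expectation (X 1)" .
  qed simp
  \<comment> \<open>Borel-Cantelli is applied to each threshold \<open>1 / Suc j\<close>; countably
    many thresholds suffice to beat every positive \<open>e\<close>.\<close>
  have "AE x in M. \<forall>j. \<forall>\<^sub>F n in sequentially. x \<in> space M - F (1 / real (Suc j)) n"
    unfolding AE_all_countable
    by (intro allI borel_cantelli_AE1 Fm summ) (auto simp: emeasure_eq_measure)
  then show ?thesis
  proof (rule AE_mp, intro AE_I2 impI)
    fix x assume x: "x \<in> space M"
      and ev: "\<forall>j. \<forall>\<^sub>F n in sequentially. x \<in> space M - F (1 / real (Suc j)) n"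
    let ?d = "\<lambda>n. (\<Sum>i=1..k n. X i x) / real (k n) - m n"
    have "?d \<longlonglongrightarrow> 0"
    proof (rule tendstoI)
      fix e :: real assume "0 < e"
      then obtain j where j: "1 / real (Suc j) < e" using nat_approx_posE by blast
      show "\<forall>\<^sub>F n in sequentially. dist (?d n) 0 < e"
        using ev[rule_format, of j] by eventually_elim (use x j in \<open>auto simp: F_def not_le\<close>)
    qed
    from tendsto_add[OF this mlim]
    show "(\<lambda>n. (\<Sum>i=1..k n. X i x) / real (k n)) \<longlonglongrightarrow> expectation (X 1)" by simp
  qed
qed

lemma (in prob_space) strong_law_nonneg:
  fixes X :: "nat \<Rightarrow> 'a \<Rightarrow> real"
  assumes ind: "indep_vars (\<lambda>_. borel) X {1..}"
    and dist: "\<And>i. 1 \<le> i \<Longrightarrow> distr M borel (X i) = distr M borel (X 1)"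
    and int: "integrable M (X 1)"
    and nn: "\<And>i x. 1 \<le> i \<Longrightarrow> x \<in> space M \<Longrightarrow> 0 \<le> X i x"
  shows "AE x in M. (\<lambda>n. (\<Sum>i=1..n. X i x) / real n) \<longlonglongrightarrow> expectation (X 1)"
proof -
  have "AE x in M. \<forall>m. (\<lambda>n. (\<Sum>i=1..nat \<lceil>(1 + 1 / real (Suc m)) ^ n\<rceil>. X i x)
      / real (nat \<lceil>(1 + 1 / real (Suc m)) ^ n\<rceil>)) \<longlonglongrightarrow> expectation (X 1)"
    unfolding AE_all_countable
    by (intro allI strong_law_nonneg_geometric_subsequence[OF ind dist int nn]) simp_all
  then show ?thesis
  proof (rule AE_mp, intro AE_I2 impI)
    fix x assume x: "x \<in> space M"
      and lim: "\<forall>m. (\<lambda>n. (\<Sum>i=1..nat \<lceil>(1 + 1 / real (Suc m)) ^ n\<rceil>. X i x)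
        / real (nat \<lceil>(1 + 1 / real (Suc m)) ^ n\<rceil>)) \<longlonglongrightarrow> expectation (X 1)"
    show "(\<lambda>n. (\<Sum>i=1..n. X i x) / real n) \<longlonglongrightarrow> expectation (X 1)"
      using lim nn x
      by (intro mean_tendsto_from_geometric_subsequences monoI sum_mono2 sum_nonneg) auto
  qed
qed

text \<open>Positive and negative parts are measurable functions of the variables, so each family
  inherits independence and a common law, and the nonnegative case applies to both.\<close>

theorem (in prob_space) strong_law_of_large_numbers:
  fixes X :: "nat \<Rightarrow> 'a \<Rightarrow> real"
  assumes ind: "indep_vars (\<lambda>_. borel) X {1..}"
    and dist: "\<And>i. 1 \<le> i \<Longrightarrow> distr M borel (X i) = distr M borel (X 1)"
    and int: "integrable M (X 1)"
  shows "AE x in M. (\<lambda>n. (\<Sum>i=1..n. X i x) / real n) \<longlonglongrightarrow> expectation (X 1)"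
proof -
  have meas: "random_variable borel (X i)" if "1 \<le> i" for i
    using ind that by (auto simp: indep_vars_def)
  have part: "AE x in M. (\<lambda>n. (\<Sum>i=1..n. g (X i x)) / real n) \<longlonglongrightarrow> expectation (\<lambda>x. g (X 1 x))"
    if g [measurable]: "g \<in> borel_measurable borel" and g0: "\<And>y. 0 \<le> g y" and gi: "integrable M (\<lambda>x. g (X 1 x))"
    for g :: "real \<Rightarrow> real"
  proof (rule strong_law_nonneg)
    show "indep_vars (\<lambda>_. borel) (\<lambda>i x. g (X i x)) {1..}"
      by (rule indep_vars_compose2[OF ind]) simp
    fix i :: nat assume i: "1 \<le> i"
    have "distr M borel (\<lambda>x. g (X j x)) = distr (distr M borel (X j)) borel g" if "1 \<le> j" for j
      using distr_distr[OF g meas[OF that]] by (simp add: comp_def)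
    then show "distr M borel (\<lambda>x. g (X i x)) = distr M borel (\<lambda>x. g (X 1 x))"
      using i dist[OF i] by (metis order_refl)
  qed (use g0 gi in auto)
  have "AE x in M. (\<lambda>n. (\<Sum>i=1..n. max 0 (X i x)) / real n) \<longlonglongrightarrow> expectation (\<lambda>x. max 0 (X 1 x))"
    using int by (intro part) auto
  moreover have "AE x in M. (\<lambda>n. (\<Sum>i=1..n. max 0 (- X i x)) / real n) \<longlonglongrightarrow> expectation (\<lambda>x. max 0 (- X 1 x))"
    using int by (intro part[of "\<lambda>y. max 0 (- y)"]) auto
  ultimately show ?thesis
  proof eventually_elim
    case (elim x)
    have d: "y = max 0 y - max 0 (- y)" for y :: real by simp
    have "expectation (X 1) = expectation (\<lambda>x. max 0 (X 1 x) - max 0 (- X 1 x))"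
      by (rule arg_cong[where f=expectation]) (rule ext, rule d)
    also have "\<dots> = expectation (\<lambda>x. max 0 (X 1 x)) - expectation (\<lambda>x. max 0 (- X 1 x))"
      using int by (intro Bochner_Integration.integral_diff) auto
    finally have E: "expectation (X 1) = \<dots>" .
    have "(\<Sum>i=1..n. X i x) / real n
        = (\<Sum>i=1..n. max 0 (X i x)) / real n - (\<Sum>i=1..n. max 0 (- X i x)) / real n" for n
      unfolding diff_divide_distrib[symmetric] sum_subtractf[symmetric] d[symmetric] ..
    then show ?case unfolding E using tendsto_diff[OF elim] by simp
  qed
qed

subsection \<open>Inverting matrices in the limit\<close>

lemma matrix_inv_mult:
  fixes A :: "real ^ 'n ^ 'n"
  assumes "invertible A"
  shows "A ** matrix_inv A = mat 1" "matrix_inv A ** A = mat 1"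
  using someI_ex[OF assms[unfolded invertible_def]] by (simp_all add: matrix_inv_def)

lemma tendsto_det:
  fixes f :: "'a \<Rightarrow> real ^ 'n ^ 'n"
  assumes "(f \<longlongrightarrow> A) F"
  shows "((\<lambda>x. det (f x)) \<longlongrightarrow> det A) F"
  unfolding det_def by (intro tendsto_intros tendsto_vec_nth assms)

text \<open>Cramer's rule writes the solution as a quotient of polynomials in the entries of
  \<open>A\<close> and \<open>c\<close>, a form in which continuity is immediate.\<close>

lemma matrix_inv_mult_cramer:
  fixes A :: "real ^ 'n ^ 'n"
  assumes "det A \<noteq> 0"
  shows "matrix_inv A *v c = (\<chi> k. det (\<chi> i j. if j = k then c $ i else A $ i $ j) / det A)"
proof -
  have "A *v (matrix_inv A *v c) = c"
    using assms by (simp add: matrix_vector_mul_assoc matrix_inv_mult invertible_det_nz)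
  then show ?thesis using cramer[OF assms] by blast
qed

lemma tendsto_matrix_inv_mult:
  fixes f :: "'a \<Rightarrow> real ^ 'n ^ 'n"
  assumes f: "(f \<longlongrightarrow> A) F" and g: "(g \<longlongrightarrow> c) F" and A: "invertible A"
  shows "((\<lambda>x. matrix_inv (f x) *v g x) \<longlongrightarrow> matrix_inv A *v c) F"
proof -
  have dA: "det A \<noteq> 0" using A by (simp add: invertible_det_nz)
  \<comment> \<open>For a singular matrix \<open>matrix_inv\<close> is an arbitrary choice, so the
    determinant formula and the inverse can be identified only eventually.\<close>
  have ev: "\<forall>\<^sub>F x in F. det (f x) \<noteq> 0"
    using tendsto_det[OF f] dA by (rule tendsto_imp_eventually_ne)
  have "((\<lambda>x. \<chi> k. det (\<chi> i j. if j = k then g x $ i else f x $ i $ j) / det (f x)) \<longlongrightarrow>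
      (\<chi> k. det (\<chi> i j. if j = k then c $ i else A $ i $ j) / det A)) F"
  proof (rule vec_tendstoI, simp only: vec_lambda_beta, intro tendsto_divide tendsto_det f dA)
    fix k
    show "((\<lambda>x. \<chi> i j. if j = k then g x $ i else f x $ i $ j) \<longlongrightarrow>
        (\<chi> i j. if j = k then c $ i else A $ i $ j)) F"
      by (intro vec_tendstoI) (simp add: tendsto_vec_nth f g)
  qed
  then show ?thesis
    unfolding matrix_inv_mult_cramer[OF dA]
    by (rule Lim_transform_eventually) (use ev in eventually_elim, simp add: matrix_inv_mult_cramer)
qed

subsection \<open>Shapley values and the Shapley kernel\<close>

text \<open>These identities turn the Shapley weight, which counts coalitions of the other players,
  into binomials over all players: the first for the coalition without the player, of size
  \<open>k\<close>, the second for the one with the player, of size \<open>Suc k\<close>.\<close>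

lemma real_binomial_absorb:
  assumes "0 < n" "k \<le> n - 1"
  shows "real n * real ((n - 1) choose k) = real (n choose k) * (real n - real k)"
    "real n * real ((n - 1) choose k) = real (n choose Suc k) * real (Suc k)"
proof -
  have "real ((n - k) * (n choose k)) = real (n * ((n - 1) choose k))"
    by (simp only: binomial_absorb_comp)
  then show "real n * real ((n - 1) choose k) = real (n choose k) * (real n - real k)"
    using assms by (simp add: of_nat_diff mult.commute)
  have "real (Suc k * (n choose Suc k)) = real (n * ((n - 1) choose k))"
    by (simp only: binomial_absorption)
  then show "real n * real ((n - 1) choose k) = real (n choose Suc k) * real (Suc k)"
    by (metis mult.commute of_nat_mult)
qed

text \<open>The subsets of each size have total weight 1, and there are \<open>card A + 1\<close>
  sizes. For the opponents of one player this is the normalization of the Shapley weights.\<close>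

lemma sum_Pow_inverse_binomial:
  assumes "finite A"
  shows "(\<Sum>S\<in>Pow A. inverse (real (card A choose card S))) = real (card A) + 1"
proof -
  have "(\<Sum>S\<in>Pow A. inverse (real (card A choose card S)))
      = (\<Sum>k\<le>card A. \<Sum>S | S \<in> Pow A \<and> card S = k. inverse (real (card A choose card S)))"
    using assms by (intro sum.group[symmetric]) (auto intro: card_mono)
  also have "\<dots> = (\<Sum>k\<le>card A. 1)"
  proof (rule sum.cong)
    fix k assume "k \<in> {..card A}"
    then show "(\<Sum>S | S \<in> Pow A \<and> card S = k. inverse (real (card A choose card S))) = 1"
      using n_subsets[OF assms, of k] by (simp add: binomial_eq_0_iff)
  qed simp
  finally show ?thesis by simp
qed

text \<open>The coefficient of \<open>v S\<close> in the value of player \<open>i\<close>. Neither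
  denominator vanishes in its branch: a coalition with a member is nonempty, and one with an
  outsider is proper.\<close>

definition shapley_coeff :: "'d::finite \<Rightarrow> 'd set \<Rightarrow> real" where
  "shapley_coeff i S =
     (if i \<in> S then 1 / (real (CARD('d) choose card S) * real (card S))
      else - 1 / (real (CARD('d) choose card S) * (real CARD('d) - real (card S))))"

text \<open>Regroups marginal contributions by coalition: each coalition occurs exactly once, either
  as some \<open>S\<close> without \<open>i\<close> or as the corresponding
  \<open>insert i S\<close>.\<close>

lemma shapley_sum_eq:
  fixes v :: "'d::finite set \<Rightarrow> real"
  shows "1 / real CARD('d) * (\<Sum>S \<in> Pow (UNIV - {i}).
           inverse (real ((CARD('d) - 1) choose card S)) * (v (insert i S) - v S))
       = (\<Sum>S\<in>UNIV. shapley_coeff i S * v S)"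
proof -
  let ?P = "Pow (UNIV - {i})"
  have U: "(UNIV :: 'd set set) = ?P \<union> insert i ` ?P"
  proof -
    have "S \<in> ?P \<union> insert i ` ?P" for S :: "'d set"
    proof (cases "i \<in> S")
      case True
      then have "S = insert i (S - {i})" by auto
      then show ?thesis by blast
    qed blast
    then show ?thesis by blast
  qed
  have inj: "inj_on (insert i) ?P" by (intro inj_onI) blast
  have "(\<Sum>S\<in>UNIV. shapley_coeff i S * v S)
      = (\<Sum>S\<in>?P. shapley_coeff i S * v S) + (\<Sum>S\<in>insert i ` ?P. shapley_coeff i S * v S)"
    by (subst U, rule sum.union_disjoint) auto
  also have "\<dots> = (\<Sum>S\<in>?P. shapley_coeff i S * v S + shapley_coeff i (insert i S) * v (insert i S))"
    by (simp add: sum.reindex[OF inj] sum.distrib)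
  also have "\<dots> = (\<Sum>S\<in>?P. 1 / real CARD('d) *
      (inverse (real ((CARD('d) - 1) choose card S)) * (v (insert i S) - v S)))"
  proof (rule sum.cong)
    fix S assume "S \<in> ?P"
    then have iS: "i \<notin> S" by auto
    then have le: "card S \<le> CARD('d) - 1"
      using card_mono[of "UNIV - {i}" S] by (simp add: card_Diff_singleton subset_Diff_insert)
    have "shapley_coeff i S = - 1 / (real CARD('d) * real ((CARD('d) - 1) choose card S))"
      using iS unfolding real_binomial_absorb(1)[OF zero_less_card_finite le]
      by (simp add: shapley_coeff_def)
    moreover have "shapley_coeff i (insert i S) = 1 / (real CARD('d) * real ((CARD('d) - 1) choose card S))"
      using iS unfolding real_binomial_absorb(2)[OF zero_less_card_finite le]
      by (simp add: shapley_coeff_def)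
    ultimately show "shapley_coeff i S * v S + shapley_coeff i (insert i S) * v (insert i S)
        = 1 / real CARD('d) * (inverse (real ((CARD('d) - 1) choose card S)) * (v (insert i S) - v S))"
      by (simp add: divide_inverse right_diff_distrib left_diff_distrib mult_ac)
  qed simp
  finally show ?thesis by (simp add: sum_distrib_left)
qed

text \<open>Efficiency at the level of coefficients. With C the binomial, the members of a proper
  nonempty \<open>S\<close> contribute 1/C in total and the outsiders -1/C; at the two extremes one
  of these groups is missing and C = 1.\<close>

lemma sum_shapley_coeff:
  fixes S :: "'d::finite set"
  shows "(\<Sum>i\<in>UNIV. shapley_coeff i S) = (if S = UNIV then 1 else if S = {} then - 1 else 0)"
proof -
  let ?C = "real (CARD('d) choose card S)"
  have le: "card S \<le> CARD('d)" by (intro card_mono) auto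
  then have C: "?C \<noteq> 0" by simp
  have "(\<Sum>i\<in>UNIV. shapley_coeff i S)
      = real (card S) / (?C * real (card S))
        - real (card (- S)) / (?C * (real CARD('d) - real (card S)))"
    unfolding shapley_coeff_def by (subst sum.If_cases) (simp_all add: Compl_eq)
  also have "real (card (- S)) = real CARD('d) - real (card S)"
    using le by (simp add: Compl_eq_Diff_UNIV card_Diff_subset of_nat_diff)
  finally have *: "(\<Sum>i\<in>UNIV. shapley_coeff i S) = real (card S) / (?C * real (card S))
        - (real CARD('d) - real (card S)) / (?C * (real CARD('d) - real (card S)))" .
  \<comment> \<open>For \<open>UNIV\<close> and \<open>{}\<close> one of the two quotients is 0 / 0,
    which evaluates to 0, so only the other one survives.\<close>
  consider "S = UNIV" | "S = {}" "S \<noteq> UNIV" | "S \<noteq> {}" "S \<noteq> UNIV" by blast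
  then show ?thesis
  proof cases
    case 3
    then have "0 < card S" "card S < CARD('d)"
      by (simp_all add: card_gt_0_iff psubset_card_mono psubset_eq)
    with 3 show ?thesis unfolding * using C by (simp add: field_simps)
  next
    case 1
    then show ?thesis unfolding * by simp
  next
    case 2
    then show ?thesis unfolding * by simp
  qed
qed

section \<open>Comparison of the Shapley coefficients with the kernel distribution\<close>

definition kernel_prob :: "'d::finite set \<Rightarrow> real" where
  "kernel_prob S = kernel_weight S / (\<Sum>T\<in>(UNIV :: 'd set set). kernel_weight T)"

text \<open>The constant kappa. For size k and C = (d choose k), the coefficients of members and
  outsiders differ by 1/(C k) + 1/(C (d - k)) = d/(C k (d - k)); dividing by
  \<open>kernel_prob S\<close> leaves this number, which no longer depends on
  \<open>S\<close>.\<close>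

definition kernel_scale :: "'d::finite itself \<Rightarrow> real" where
  "kernel_scale _ =
     real CARD('d) * (\<Sum>T\<in>(UNIV :: 'd set set). kernel_weight T) / (real CARD('d) - 1)"

text \<open>The coefficient of an outsider of \<open>S\<close>. Only \<open>UNIV\<close> has no
  outsiders; its kernel probability is 0, so there the shift has to be the common coefficient of the
  members.\<close>

definition shapley_shift :: "'d::finite set \<Rightarrow> real" where
  "shapley_shift S =
     (if S = UNIV then 1 / real CARD('d) else if S = {} then - 1 / real CARD('d)
      else - 1 / (real (CARD('d) choose card S) * (real CARD('d) - real (card S))))"

lemma kernel_weight_nonneg: "0 \<le> kernel_weight (S :: 'd::finite set)"
  by (auto simp: kernel_weight_def Let_def intro!: divide_nonneg_nonneg mult_nonneg_nonneg)

lemma kernel_weight_singleton_pos: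
  assumes "CARD('d::finite) \<ge> 2"
  shows "0 < kernel_weight {i :: 'd}"
  using assms by (simp add: kernel_weight_def Let_def)

lemma sum_kernel_weight_pos:
  assumes "CARD('d::finite) \<ge> 2"
  shows "0 < (\<Sum>T\<in>(UNIV :: 'd set set). kernel_weight T)"
  using kernel_weight_singleton_pos[OF assms] kernel_weight_nonneg
  by (intro sum_pos2[where i="{undefined :: 'd}"]) auto

lemma kernel_prob_nonneg: "0 \<le> kernel_prob (S :: 'd::finite set)"
  by (simp add: kernel_prob_def kernel_weight_nonneg sum_nonneg)

lemma kernel_scale_pos:
  assumes "CARD('d::finite) \<ge> 2"
  shows "0 < kernel_scale TYPE('d)"
  using assms sum_kernel_weight_pos[OF assms] by (simp add: kernel_scale_def)

lemma shapley_coeff_decomposition: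
  fixes S :: "'d::finite set"
  assumes d: "CARD('d) \<ge> 2"
  shows "shapley_coeff i S =
    kernel_scale TYPE('d) * (kernel_prob S * (if i \<in> S then 1 else 0)) + shapley_shift S"
proof -
  let ?W = "\<Sum>T\<in>(UNIV :: 'd set set). kernel_weight T"
  have W: "?W \<noteq> 0" using sum_kernel_weight_pos[OF d] by simp
  consider "S = UNIV" | "S = {}" "S \<noteq> UNIV" | "S \<noteq> {}" "S \<noteq> UNIV" by blast
  then show ?thesis
  proof cases
    case 3
    then have s: "0 < card S" "card S < CARD('d)"
      by (simp_all add: card_gt_0_iff psubset_card_mono psubset_eq)
    then have C: "0 < real (CARD('d) choose card S)" by simp
    have "kernel_scale TYPE('d) * kernel_prob S
        = real CARD('d) / (real (CARD('d) choose card S) * real (card S) * (real CARD('d) - real (card S)))"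
      using s d W by (simp add: kernel_scale_def kernel_prob_def kernel_weight_def Let_def)
    then show ?thesis
      using 3 s C by (simp add: shapley_coeff_def shapley_shift_def field_simps)
  qed (use d in \<open>simp_all add: shapley_coeff_def shapley_shift_def kernel_prob_def kernel_weight_def\<close>)
qed

lemma shapley_sum_decomposition:
  fixes v :: "'d::finite set \<Rightarrow> real"
  assumes "CARD('d) \<ge> 2"
  shows "(\<Sum>S\<in>UNIV. shapley_coeff i S * v S) =
    kernel_scale TYPE('d) * (\<Sum>S\<in>UNIV. kernel_prob S * v S * (if i \<in> S then 1 else 0))
    + (\<Sum>S\<in>UNIV. shapley_shift S * v S)"
  by (simp add: shapley_coeff_decomposition[OF assms] sum_distrib_left sum.distrib[symmetric] algebra_simps)

section \<open>The second moment matrix: entries, positivity, invertibility\<close>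

lemma kernel_second_moment_nth:
  "kernel_second_moment $ i $ j =
     (\<Sum>S\<in>(UNIV::'d::finite set set). kernel_prob S * (if j \<in> S then 1 else 0) * (if i \<in> S then 1 else 0))"
proof -
  have nn: "0 \<le> kernel_weight S / (\<Sum>T\<in>(UNIV :: 'd set set). kernel_weight T)" for S :: "'d set"
    using kernel_prob_nonneg[of S] by (simp add: kernel_prob_def)
  \<comment> \<open>The factor for \<open>j\<close> stands first so that the entry has the shape
    \<open>kernel_prob S * v S * (if i \<in> S then 1 else 0)\<close> with \<open>v\<close> the
    dictator game of \<open>j\<close>, as in \<open>shapley_sum_decomposition\<close>.\<close>
  have o: "outer (coalition_vec S) $ i $ j = (if j \<in> S then 1 else 0) * (if i \<in> S then 1 else 0)" for S :: "'d set"
    by (simp add: outer_def matrix_matrix_mult_def columnvector_def rowvector_def coalition_vec_def)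
  show ?thesis
    unfolding kernel_second_moment_def shapley_kernel_def
    by (subst lebesgue_integral_point_measure_finite) (auto simp: nn o kernel_prob_def intro!: sum.cong)
qed

lemma kernel_mean_nth:
  "kernel_mean $ i = (\<Sum>S\<in>(UNIV::'d::finite set set). kernel_prob S * (if i \<in> S then 1 else 0))"
proof -
  have nn: "0 \<le> kernel_weight S / (\<Sum>T\<in>(UNIV :: 'd set set). kernel_weight T)" for S :: "'d set"
    using kernel_prob_nonneg[of S] by (simp add: kernel_prob_def)
  show ?thesis
    unfolding kernel_mean_def shapley_kernel_def
    by (subst lebesgue_integral_point_measure_finite)
      (auto simp: nn coalition_vec_def kernel_prob_def intro!: sum.cong)
qed

text \<open>Evaluating the decomposition of the Shapley values on the dictator game of player \<open>j\<close>,
  whose Shapley values are the \<open>j\<close>-th unit vector, identifies the second moment matrix.\<close>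

lemma kernel_second_moment_scaled:
  assumes d: "CARD('d::finite) \<ge> 2"
  shows "kernel_scale TYPE('d) * (kernel_second_moment :: real ^ 'd ^ 'd) $ i $ j =
    (if i = j then 1 else 0) - (\<Sum>S\<in>UNIV. shapley_shift S * (if j \<in> S then 1 else 0))"
proof -
  have "(\<Sum>S\<in>UNIV. shapley_coeff i S * (if j \<in> S then 1 else 0 :: real)) =
      1 / real CARD('d) * (\<Sum>S \<in> Pow (UNIV - {i}).
           inverse (real ((CARD('d) - 1) choose card S)) *
             ((if j \<in> insert i S then 1 else 0) - (if j \<in> S then 1 else 0)))"
    by (rule shapley_sum_eq[symmetric])
  also have "\<dots> = 1 / real CARD('d) * (\<Sum>S \<in> Pow (UNIV - {i}).
           inverse (real ((CARD('d) - 1) choose card S)) * (if i = j then 1 else 0))"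
    by (intro arg_cong2[where f="(*)"] sum.cong refl) auto
  also have "\<dots> = (if i = j then 1 else 0)"
  proof -
    have "(\<Sum>S \<in> Pow (UNIV - {i}). inverse (real ((CARD('d) - 1) choose card S))) = real CARD('d)"
      using sum_Pow_inverse_binomial[of "UNIV - {i}"] d
      by (simp add: card_Diff_singleton of_nat_diff)
    then show ?thesis unfolding sum_distrib_right[symmetric] by simp
  qed
  finally show ?thesis
    using shapley_sum_decomposition[OF d, of i "\<lambda>S. if j \<in> S then 1 else 0"]
    by (simp add: kernel_second_moment_nth)
qed

lemma kernel_second_moment_quadratic_form:
  "x \<bullet> (kernel_second_moment *v x)
     = (\<Sum>S\<in>(UNIV::'d::finite set set). kernel_prob S * (\<Sum>i\<in>S. x $ i)\<^sup>2)"
proof -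
  have "x \<bullet> (kernel_second_moment *v x) = (\<Sum>i\<in>UNIV. \<Sum>j\<in>UNIV. \<Sum>S\<in>(UNIV::'d set set).
      kernel_prob S * ((if i \<in> S then x $ i else 0) * (if j \<in> S then x $ j else 0)))"
    by (auto simp: inner_vec_def matrix_vector_mult_def kernel_second_moment_nth sum_distrib_left
        sum_distrib_right intro!: sum.cong)
  also have "\<dots> = (\<Sum>S\<in>(UNIV::'d set set). \<Sum>i\<in>UNIV. \<Sum>j\<in>UNIV.
      kernel_prob S * ((if i \<in> S then x $ i else 0) * (if j \<in> S then x $ j else 0)))"
    by (rule trans[OF sum.cong[OF refl sum.swap] sum.swap])
  also have "\<dots> = (\<Sum>S\<in>(UNIV::'d set set). kernel_prob S * (\<Sum>i\<in>UNIV. if i \<in> S then x $ i else 0)\<^sup>2)"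
    unfolding power2_eq_square sum_product unfolding sum_distrib_left ..
  also have "\<dots> = (\<Sum>S\<in>(UNIV::'d set set). kernel_prob S * (\<Sum>i\<in>S. x $ i)\<^sup>2)"
    by (simp add: sum.If_cases)
  finally show ?thesis .
qed

text \<open>Singletons are proper coalitions of positive probability and already detect every
  coordinate: the term of \<open>{i}\<close> is a positive multiple of
  \<open>(x $ i)\<^sup>2\<close>, and no other term is negative.\<close>

lemma kernel_second_moment_pos_def:
  fixes x :: "real ^ 'd::finite"
  assumes d: "CARD('d) \<ge> 2" and x: "x \<noteq> 0"
  shows "0 < x \<bullet> (kernel_second_moment *v x)"
proof -
  obtain i where i: "x $ i \<noteq> 0" using x by (auto simp: vec_eq_iff)
  have "0 < kernel_prob {i}"
    using kernel_weight_singleton_pos[OF d] sum_kernel_weight_pos[OF d] by (simp add: kernel_prob_def)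
  then show ?thesis
    unfolding kernel_second_moment_quadratic_form using i
    by (intro sum_pos2[where i="{i}"]) (auto simp: kernel_prob_nonneg)
qed

lemma kernel_second_moment_invertible:
  assumes d: "CARD('d::finite) \<ge> 2"
  shows "invertible (kernel_second_moment :: real ^ 'd ^ 'd)"
proof -
  have "x = 0" if "kernel_second_moment *v x = 0" for x :: "real ^ 'd"
    using kernel_second_moment_pos_def[OF d, of x] that by auto
  then show ?thesis
    by (simp add: invertible_left_inverse matrix_left_invertible_ker)
qed

text \<open>The denominator of the constrained solution. For the vector y with A y = 1 it equals the
  quadratic form of A itself at y.\<close>

lemma one_inverse_second_moment_one_pos:
  assumes d: "CARD('d::finite) \<ge> 2"
  shows "0 < (1 :: real ^ 'd) \<bullet> (matrix_inv kernel_second_moment *v 1)"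
proof -
  let ?A = "kernel_second_moment :: real ^ 'd ^ 'd"
  let ?y = "matrix_inv ?A *v 1"
  have Ay: "?A *v ?y = 1"
    by (simp add: matrix_vector_mul_assoc matrix_inv_mult kernel_second_moment_invertible[OF d])
  have "(1 :: real ^ 'd) \<noteq> 0" by (simp add: vec_eq_iff)
  then have "?y \<noteq> 0" using Ay by auto
  then show ?thesis using kernel_second_moment_pos_def[OF d, of ?y] Ay by (simp add: inner_commute)
qed

text \<open>For symmetric \<open>A\<close> the last two hypotheses are the Lagrange conditions for
  minimizing \<open>x \<bullet> (A *v x) - 2 * (b \<bullet> x)\<close> with prescribed coordinate
  sum. Solving the constraint for the multiplier shows that the quotient in
  \<open>constrained_solution\<close> is \<open>- l\<close>.\<close>

lemma constrained_solution_unique: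
  fixes A :: "real ^ 'd ^ 'd::finite"
  assumes A: "invertible A" and q: "1 \<bullet> (matrix_inv A *v 1) \<noteq> 0"
    and stationary: "A *v x = b + l *\<^sub>R 1"
    and constraint: "1 \<bullet> x = game_mean P U V UNIV - game_mean P U V {}"
  shows "constrained_solution P U V A b = x"
proof -
  have "x = matrix_inv A *v (A *v x)"
    by (simp add: matrix_vector_mul_assoc matrix_inv_mult A)
  also have "\<dots> = matrix_inv A *v b + l *\<^sub>R (matrix_inv A *v 1)"
    by (simp add: stationary matrix_vector_right_distrib matrix_vector_mult_scaleR)
  finally have x: "x = matrix_inv A *v b + l *\<^sub>R (matrix_inv A *v 1)" .
  have "1 \<bullet> x = 1 \<bullet> (matrix_inv A *v b) + l * (1 \<bullet> (matrix_inv A *v 1))"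
    by (subst x) (simp add: inner_add_right)
  then have "(1 \<bullet> (matrix_inv A *v b) - game_mean P U V UNIV + game_mean P U V {})
      / (1 \<bullet> (matrix_inv A *v 1)) = - l"
    using q constraint by (simp add: field_simps)
  then show ?thesis
    by (simp add: constrained_solution_def x matrix_vector_right_distrib matrix_vector_mult_scaleR)
qed

text \<open>Only differences of game values enter, so every value may be centered at that of
  \<open>{}\<close>. This matches the centering in \<open>b_tilde\<close> and makes the empty
  coalition drop out of the efficiency sum.\<close>

lemma shapley_values_nth:
  fixes V :: "'d::finite set \<Rightarrow> 'u \<Rightarrow> real"
  assumes "\<And>S. integrable P (\<lambda>w. V S (U w))"
  shows "shapley_values P U V $ i =
    (\<Sum>S\<in>UNIV. shapley_coeff i S * (game_mean P U V S - game_mean P U V {}))"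
proof -
  have "shapley_values P U V $ i = 1 / real CARD('d) * (\<Sum>S \<in> Pow (UNIV - {i}).
           inverse (real ((CARD('d) - 1) choose card S)) *
           ((game_mean P U V (insert i S) - game_mean P U V {}) - (game_mean P U V S - game_mean P U V {})))"
    using assms by (simp add: shapley_values_def game_mean_def)
  then show ?thesis unfolding shapley_sum_eq[where v="\<lambda>S. game_mean P U V S - game_mean P U V {}"] .
qed

text \<open>With v the mean game, this is E[Z (v(Z) - v(0))]: the almost sure limit of both sampled
  vectors, and the exact expectation of \<open>b_tilde_unbiased\<close>.\<close>

definition kernel_target :: "'w measure \<Rightarrow> ('w \<Rightarrow> 'u) \<Rightarrow> ('d::finite set \<Rightarrow> 'u \<Rightarrow> real) \<Rightarrow> real ^ 'd" where
  "kernel_target P U V =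
     (\<Sum>S\<in>UNIV. (kernel_prob S * (game_mean P U V S - game_mean P U V {})) *\<^sub>R coalition_vec S)"

lemma constrained_solution_eq_shapley_values:
  fixes V :: "'d::finite set \<Rightarrow> 'u \<Rightarrow> real"
  assumes d: "CARD('d) \<ge> 2" and V: "\<And>S. integrable P (\<lambda>w. V S (U w))"
  shows "constrained_solution P U V kernel_second_moment (kernel_target P U V) = shapley_values P U V"
proof -
  let ?A = "kernel_second_moment :: real ^ 'd ^ 'd"
  let ?k = "kernel_scale TYPE('d)"
  let ?x = "shapley_values P U V"
  define v where "v S = game_mean P U V S - game_mean P U V {}" for S
  define G where "G j = (\<Sum>S\<in>UNIV. shapley_shift S * (if j \<in> S then 1 else 0))" for j :: 'd
  define H where "H = (\<Sum>S\<in>UNIV. shapley_shift S * v S)"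
  have k: "0 < ?k" by (rule kernel_scale_pos[OF d])
  have x: "?x $ i = (\<Sum>S\<in>UNIV. shapley_coeff i S * v S)" for i
    unfolding v_def by (rule shapley_values_nth) (rule V)
  have "(\<Sum>i\<in>UNIV. ?x $ i) = (\<Sum>S\<in>UNIV. (\<Sum>i\<in>UNIV. shapley_coeff i S) * v S)"
    unfolding x sum_distrib_right by (rule sum.swap)
  \<comment> \<open>Of the two coalitions with nonzero coefficient sum, the empty one vanishes
    because \<open>v {} = 0\<close>.\<close>
  also have "\<dots> = (\<Sum>S\<in>UNIV. if S = UNIV then v S else 0)"
    unfolding sum_shapley_coeff by (intro sum.cong) (auto simp: v_def)
  finally have eff: "(\<Sum>i\<in>UNIV. ?x $ i) = v UNIV" by simp
  have Aij: "?k * ?A $ i $ j = (if i = j then 1 else 0) - G j" for i j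
    unfolding G_def by (rule kernel_second_moment_scaled[OF d])
  have sym: "?A $ i $ j = ?A $ j $ i" for i j
    unfolding kernel_second_moment_nth by (simp only: mult_ac)
  \<comment> \<open>Off the diagonal the scaled entry is \<open>- G j\<close>, which depends on the
    column alone; symmetry of the matrix therefore makes \<open>G\<close> constant.\<close>
  define g where "g = G undefined"
  have G: "G j = g" for j
    unfolding g_def
    using Aij[of undefined j] Aij[of j undefined] sym[of undefined j] by (cases "j = undefined") auto
  have b: "kernel_target P U V $ i = (\<Sum>S\<in>UNIV. kernel_prob S * v S * (if i \<in> S then 1 else 0))" for i
    by (simp add: kernel_target_def v_def coalition_vec_def)
  \<comment> \<open>The multiplier collects the two contributions common to all players:
    \<open>H\<close> from the decomposition of the Shapley values, and \<open>- g * v UNIV\<close>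
    from the rank-one part of the matrix combined with efficiency.\<close>
  have "?A *v ?x = kernel_target P U V + ((H - g * v UNIV) / ?k) *\<^sub>R 1"
  proof (rule vec_eq_iff[THEN iffD2, rule_format])
    fix i
    have "?k * (?A *v ?x) $ i = (\<Sum>j\<in>UNIV. (?k * ?A $ i $ j) * ?x $ j)"
      by (simp add: matrix_vector_mult_def sum_distrib_left mult.assoc)
    also have "\<dots> = (\<Sum>j\<in>UNIV. (if i = j then ?x $ j else 0) - g * ?x $ j)"
      unfolding Aij G by (intro sum.cong) (auto simp: left_diff_distrib)
    also have "\<dots> = ?x $ i - g * v UNIV"
      by (simp add: sum_subtractf sum_distrib_left[symmetric] eff)
    also have "?x $ i = ?k * kernel_target P U V $ i + H"
      unfolding x b H_def by (rule shapley_sum_decomposition[OF d])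
    finally show "(?A *v ?x) $ i
        = (kernel_target P U V + ((H - g * v UNIV) / ?k) *\<^sub>R 1) $ i"
      using k by (simp add: field_simps)
  qed
  moreover have "1 \<bullet> ?x = game_mean P U V UNIV - game_mean P U V {}"
    using eff by (simp add: inner_vec_def v_def)
  ultimately show ?thesis
    using one_inverse_second_moment_one_pos[OF d]
    by (intro constrained_solution_unique kernel_second_moment_invertible[OF d]) auto
qed

subsection \<open>The estimators\<close>

text \<open>\<open>indep_var\<close> requires both variables to have values in one type, so
  independence of a coalition and a sample of \<open>U\<close> is expressed by generated
  sigma-algebras. Composition only shrinks these, and it brings both values into
  \<open>K\<close>.\<close>

lemma (in prob_space) indep_var_compose_indep_set:
  assumes X: "X \<in> measurable M S" and Y: "Y \<in> measurable M T"
    and ind: "indep_set (sigma_sets (space M) {X -` A \<inter> space M | A. A \<in> sets S})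
      (sigma_sets (space M) {Y -` B \<inter> space M | B. B \<in> sets T})"
    and f: "f \<in> measurable S K" and g: "g \<in> measurable T K"
  shows "indep_var K (\<lambda>x. f (X x)) K (\<lambda>x. g (Y x))"
proof -
  have sub: "sigma_sets (space M) {(\<lambda>x. h (Z x)) -` A \<inter> space M | A. A \<in> sets K}
      \<subseteq> sigma_sets (space M) {Z -` A \<inter> space M | A. A \<in> sets R}"
    if Z: "Z \<in> measurable M R" and h: "h \<in> measurable R K" for Z h R
  proof (rule sigma_sets_mono, safe)
    fix A assume A: "A \<in> sets K"
    have eq: "(\<lambda>x. h (Z x)) -` A \<inter> space M = Z -` (h -` A \<inter> space R) \<inter> space M"
      using measurable_space[OF Z] by auto
    show "(\<lambda>x. h (Z x)) -` A \<inter> space M \<in> sigma_sets (space M) {Z -` A \<inter> space M | A. A \<in> sets R}"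
      unfolding eq by (rule sigma_sets.Basic) (use measurable_sets[OF h A] in blast)
  qed
  have "indep_set (sigma_sets (space M) {(\<lambda>x. f (X x)) -` A \<inter> space M | A. A \<in> sets K})
      (sigma_sets (space M) {(\<lambda>x. g (Y x)) -` B \<inter> space M | B. B \<in> sets K})"
    using ind unfolding indep_set_def
    by (rule indep_sets_mono_sets) (use sub[OF X f] sub[OF Y g] in \<open>auto split: bool.split\<close>)
  then show ?thesis
    unfolding indep_var_eq using measurable_compose[OF X f] measurable_compose[OF Y g] by blast
qed

text \<open>Splitting by the finitely many values of \<open>z\<close> turns the integrand into a sum
  of products of an indicator of \<open>z\<close> and a function of \<open>u\<close>, and
  independence factors each product.\<close>

lemma (in prob_space) expectation_finite_mixture:
  fixes z :: "'a \<Rightarrow> 'c::finite" and F :: "'c \<Rightarrow> 'u \<Rightarrow> real"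
  assumes z [measurable]: "z \<in> measurable M (count_space UNIV)" and u: "u \<in> measurable M N"
    and ind: "indep_set (sigma_sets (space M) {z -` A \<inter> space M | A. A \<in> sets (count_space UNIV)})
      (sigma_sets (space M) {u -` B \<inter> space M | B. B \<in> sets N})"
    and F: "\<And>S. F S \<in> borel_measurable N" and int: "\<And>S. integrable M (\<lambda>\<omega>. F S (u \<omega>))"
  shows "integrable M (\<lambda>\<omega>. F (z \<omega>) (u \<omega>))"
    and "expectation (\<lambda>\<omega>. F (z \<omega>) (u \<omega>))
      = (\<Sum>S\<in>UNIV. measure (distr M (count_space UNIV) z) {S} * expectation (\<lambda>\<omega>. F S (u \<omega>)))"
proof -
  have eq: "F (z \<omega>) (u \<omega>) = (\<Sum>S\<in>UNIV. indicator {S} (z \<omega>) * F S (u \<omega>))" for \<omega>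
    by (simp add: indicator_def)
  have comp: "indep_var borel (\<lambda>\<omega>. indicator {S} (z \<omega>) :: real) borel (\<lambda>\<omega>. F S (u \<omega>))" for S
    by (rule indep_var_compose_indep_set[OF z u ind _ F]) simp
  have ii: "integrable M (\<lambda>\<omega>. indicator {S} (z \<omega>) :: real)" for S
    by (intro integrable_const_bound[where B=1]) (auto simp: indicator_def)
  have iE: "expectation (\<lambda>\<omega>. indicator {S} (z \<omega>)) = measure (distr M (count_space UNIV) z) {S}" for S
  proof -
    have "expectation (\<lambda>\<omega>. indicator {S} (z \<omega>) :: real)
        = (\<integral>x. indicator {S} x \<partial>distr M (count_space UNIV) z)"
      by (rule integral_distr[symmetric]) simp_all
    then show ?thesis by simp
  qed
  note prod = indep_var_integrable[OF comp ii int] indep_var_lebesgue_integral[OF comp ii int]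
  show "integrable M (\<lambda>\<omega>. F (z \<omega>) (u \<omega>))"
    unfolding eq by (intro Bochner_Integration.integrable_sum prod(1))
  show "expectation (\<lambda>\<omega>. F (z \<omega>) (u \<omega>))
      = (\<Sum>S\<in>UNIV. measure (distr M (count_space UNIV) z) {S} * expectation (\<lambda>\<omega>. F S (u \<omega>)))"
    unfolding eq Bochner_Integration.integral_sum[OF prod(1)] prod(2) iE ..
qed

lemma measure_shapley_kernel:
  "measure shapley_kernel {S :: 'd::finite set} = kernel_prob S"
  unfolding shapley_kernel_def using kernel_prob_nonneg[of S]
  by (simp add: measure_def emeasure_point_measure_finite kernel_prob_def)

lemma integrable_vec_componentwise:
  fixes f :: "'a \<Rightarrow> real ^ 'd::finite"
  assumes "\<And>k. integrable M (\<lambda>x. f x $ k)"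
  shows "integrable M f"
proof -
  have eq: "f = (\<lambda>x. \<Sum>k\<in>UNIV. (f x $ k) *\<^sub>R axis k 1)"
    by (simp add: fun_eq_iff basis_expansion flip: scalar_mult_eq_scaleR)
  show ?thesis
    by (subst eq) (intro Bochner_Integration.integrable_sum integrable_scaleR_left assms)
qed

lemma tendsto_constrained_solution:
  fixes f :: "'a \<Rightarrow> real ^ 'd ^ 'd::finite"
  assumes f: "(f \<longlongrightarrow> A) F" and g: "(g \<longlongrightarrow> c) F" and A: "invertible A"
    and q: "1 \<bullet> (matrix_inv A *v 1) \<noteq> 0"
  shows "((\<lambda>x. constrained_solution P U V (f x) (g x)) \<longlongrightarrow> constrained_solution P U V A c) F"
  unfolding constrained_solution_def
  by (intro tendsto_matrix_inv_mult f A tendsto_diff tendsto_scaleR tendsto_divide tendsto_add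
      tendsto_inner tendsto_const g q)

text \<open>An affine map commutes with the expectation, which is all that unbiasedness asks. The
  matrix is held fixed here; this is what distinguishes the unbiased estimator from the one built on
  the random \<open>A_hat\<close>.\<close>

lemma constrained_solution_affine:
  obtains L k where "bounded_linear L" "\<And>c. constrained_solution P U V A c = L c + k"
proof
  let ?T = "\<lambda>c. matrix_inv A *v c"
  let ?q = "1 \<bullet> ?T 1"
  have T: "bounded_linear ?T" by (rule matrix_vector_mul_bounded_linear)
  show "bounded_linear (\<lambda>c. ?T c - ((1 \<bullet> ?T c) / ?q) *\<^sub>R ?T 1)"
    by (intro bounded_linear_sub T bounded_linear_scaleR_const
        bounded_linear_compose[OF bounded_linear_divide]
        bounded_linear_compose[OF bounded_linear_inner_right T])
  show "constrained_solution P U V A c = ?T c - ((1 \<bullet> ?T c) / ?q) *\<^sub>R ?T 1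
      + ((game_mean P U V UNIV - game_mean P U V {}) / ?q) *\<^sub>R ?T 1" for c
    by (simp add: constrained_solution_def matrix_vector_mult_diff_distrib matrix_vector_mult_scaleR
        scaleR_left_distrib[symmetric] scaleR_left_diff_distrib[symmetric]
        diff_divide_distrib add_divide_distrib) (simp add: algebra_simps)
qed

section \<open>Estimators and their limits entry by entry\<close>

lemma A_hat_nth:
  "A_hat zs n $ i $ j = (\<Sum>m=1..n. (if j \<in> zs m then 1 else 0) * (if i \<in> zs m then 1 else 0)) / real n"
  by (simp add: A_hat_def outer_def matrix_matrix_mult_def columnvector_def rowvector_def
      coalition_vec_def sum_component mult.commute)

lemma b_tilde_nth:
  "b_tilde P U V zs us n $ i
     = (\<Sum>m=1..n. (V (zs m) (us m) - game_mean P U V {}) * (if i \<in> zs m then 1 else 0)) / real n"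
  by (simp add: b_tilde_def coalition_vec_def sum_component)

lemma b_tilde_unbiased_nth:
  "b_tilde_unbiased P U V zs us n $ i
     = (\<Sum>m=1..n. V (zs m) (us m) * (if i \<in> zs m then 1 else 0)) / real n
       - game_mean P U V {} * kernel_mean $ i"
  by (simp add: b_tilde_unbiased_def coalition_vec_def sum_component)

lemma kernel_target_nth:
  "kernel_target P U V $ i
     = (\<Sum>S\<in>UNIV. kernel_prob S * ((game_mean P U V S - game_mean P U V {}) * (if i \<in> S then 1 else 0)))"
  by (simp add: kernel_target_def coalition_vec_def mult.assoc)

text \<open>Pulling the centering out of the sum produces the exact mean of Z, the term that
  \<open>b_tilde_unbiased\<close> subtracts instead of estimating it from the samples.\<close>

lemma kernel_target_nth':
  "kernel_target P U V $ i
     = (\<Sum>S\<in>UNIV. kernel_prob S * (game_mean P U V S * (if i \<in> S then 1 else 0)))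
       - game_mean P U V {} * kernel_mean $ i"
  unfolding kernel_target_nth kernel_mean_nth sum_distrib_left sum_subtractf[symmetric]
  by (simp add: algebra_simps)


theorem mainTheorem5:
  fixes P :: "'w measure" and N :: "'u measure" and M :: "'s measure"
    and U :: "'w \<Rightarrow> 'u"
    and V :: "'d::finite set \<Rightarrow> 'u \<Rightarrow> real"
    and z :: "nat \<Rightarrow> 's \<Rightarrow> 'd set" and u :: "nat \<Rightarrow> 's \<Rightarrow> 'u"
  assumes "CARD('d) \<ge> 2"
    and "prob_space P" and "U \<in> measurable P N"
    and "\<And>S. V S \<in> borel_measurable N"
    and "\<And>S. integrable P (\<lambda>w. V S (U w))"
    and "prob_space M"
    and "\<And>i. i \<ge> 1 \<Longrightarrow> z i \<in> measurable M (count_space UNIV)"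
    and "\<And>i. i \<ge> 1 \<Longrightarrow> u i \<in> measurable M N"
    and "\<And>i. i \<ge> 1 \<Longrightarrow> distr M (count_space UNIV) (z i) = shapley_kernel"
    and "\<And>i. i \<ge> 1 \<Longrightarrow> distr M N (u i) = distr P N U"
    and "\<And>i. i \<ge> 1 \<Longrightarrow> prob_space.indep_set M
           (sigma_sets (space M) {z i -` A \<inter> space M | A. A \<in> sets (count_space UNIV)})
           (sigma_sets (space M) {u i -` B \<inter> space M | B. B \<in> sets N})"
    and "prob_space.indep_vars M (\<lambda>_. count_space UNIV \<Otimes>\<^sub>M N) (\<lambda>i \<omega>. (z i \<omega>, u i \<omega>)) {1..}"
  shows "(AE \<omega> in M.
            (\<lambda>n. stochastic_kernelshap P U V (\<lambda>i. z i \<omega>) (\<lambda>i. u i \<omega>) n)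
              \<longlonglongrightarrow> shapley_values P U V)
       \<and> (\<forall>n\<ge>1.
            integrable M (\<lambda>\<omega>. stochastic_unbiased_kernelshap P U V (\<lambda>i. z i \<omega>) (\<lambda>i. u i \<omega>) n) \<and>
            (\<integral>\<omega>. stochastic_unbiased_kernelshap P U V (\<lambda>i. z i \<omega>) (\<lambda>i. u i \<omega>) n \<partial>M)
              = shapley_values P U V)
       \<and> (AE \<omega> in M.
            (\<lambda>n. stochastic_unbiased_kernelshap P U V (\<lambda>i. z i \<omega>) (\<lambda>i. u i \<omega>) n)
              \<longlonglongrightarrow> shapley_values P U V)"
proof -
  note d = assms(1)
  interpret P: prob_space P by fact
  interpret M: prob_space M by fact
  have zm: "z i \<in> measurable M (count_space UNIV)" if "i \<ge> 1" for i using assms(7) that .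
  have um: "u i \<in> measurable M N" if "i \<ge> 1" for i using assms(8) that .
  note ind = assms(11)
  \<comment> \<open>The spaces \<open>P\<close> and \<open>M\<close> are linked only by the laws of
    the samples. Each estimator entry is, up to a constant, an average of some
    \<open>F (z m) (u m)\<close>, so this fact and \<open>slln\<close> carry all the probability
    needed below.\<close>
  have sample: "integrable M (\<lambda>\<omega>. F (z i \<omega>) (u i \<omega>))"
    "M.expectation (\<lambda>\<omega>. F (z i \<omega>) (u i \<omega>)) = (\<Sum>S\<in>UNIV. kernel_prob S * (\<integral>w. F S (U w) \<partial>P))"
    if F: "\<And>S. F S \<in> borel_measurable N" and int: "\<And>S. integrable P (\<lambda>w. F S (U w))" and i: "i \<ge> 1"
    for F :: "'d set \<Rightarrow> 'u \<Rightarrow> real" and i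
  proof -
    have iu: "integrable M (\<lambda>\<omega>. F S (u i \<omega>))" for S
      using integrable_distr_eq[OF um[OF i] F] integrable_distr_eq[OF assms(3) F] int assms(10)[OF i]
      by metis
    have Eu: "M.expectation (\<lambda>\<omega>. F S (u i \<omega>)) = (\<integral>w. F S (U w) \<partial>P)" for S
      using integral_distr[OF um[OF i] F] integral_distr[OF assms(3) F] assms(10)[OF i] by metis
    note mix = M.expectation_finite_mixture[OF zm[OF i] um[OF i] ind[OF i] F iu]
    show "integrable M (\<lambda>\<omega>. F (z i \<omega>) (u i \<omega>))" by (rule mix(1))
    show "M.expectation (\<lambda>\<omega>. F (z i \<omega>) (u i \<omega>)) = (\<Sum>S\<in>UNIV. kernel_prob S * (\<integral>w. F S (U w) \<partial>P))"
      using mix(2) by (simp only: assms(9)[OF i] measure_shapley_kernel Eu)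
  qed
  have slln: "AE \<omega> in M. (\<lambda>n. (\<Sum>m=1..n. F (z m \<omega>) (u m \<omega>)) / real n)
      \<longlonglongrightarrow> (\<Sum>S\<in>UNIV. kernel_prob S * (\<integral>w. F S (U w) \<partial>P))"
    if F: "\<And>S. F S \<in> borel_measurable N" and int: "\<And>S. integrable P (\<lambda>w. F S (U w))"
    for F :: "'d set \<Rightarrow> 'u \<Rightarrow> real"
  proof -
    define G where "G = (\<lambda>p. F (fst p) (snd p))"
    \<comment> \<open>The coalitions form a countable discrete factor, so measurability can be
      checked for each fixed coalition.\<close>
    have G: "G \<in> borel_measurable (count_space UNIV \<Otimes>\<^sub>M N)"
      unfolding G_def by (rule measurable_pair_measure_countable1) (auto simp: F)
    have Gm: "(\<lambda>\<omega>. G (z i \<omega>, u i \<omega>)) \<in> borel_measurable M" if i: "i \<ge> 1" for i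
      using measurable_compose[OF measurable_Pair[OF zm[OF i] um[OF i]] G] .
    \<comment> \<open>Independence within a pair determines the law: \<open>sample\<close>, applied
      to the indicator of \<open>B\<close>, expresses the probability of \<open>B\<close> by a sum
      that does not involve the index.\<close>
    have dG: "distr M borel (\<lambda>\<omega>. G (z i \<omega>, u i \<omega>)) = distr M borel (\<lambda>\<omega>. G (z 1 \<omega>, u 1 \<omega>))"
      if i: "i \<ge> 1" for i
    proof (rule measure_eqI)
      fix B :: "real set" assume "B \<in> sets (distr M borel (\<lambda>\<omega>. G (z i \<omega>, u i \<omega>)))"
      then have B [measurable]: "B \<in> sets borel" by simp
      have mB: "measure (distr M borel (\<lambda>\<omega>. G (z j \<omega>, u j \<omega>))) B
          = (\<Sum>S\<in>UNIV. kernel_prob S * (\<integral>w. indicator B (F S (U w)) \<partial>P))" if j: "j \<ge> 1" for j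
      proof -
        have "measure (distr M borel (\<lambda>\<omega>. G (z j \<omega>, u j \<omega>))) B
            = (\<integral>y. indicator B y \<partial>distr M borel (\<lambda>\<omega>. G (z j \<omega>, u j \<omega>)))" by simp
        also have "\<dots> = M.expectation (\<lambda>\<omega>. indicator B (F (z j \<omega>) (u j \<omega>)))"
          using Gm[OF j] by (subst integral_distr) (simp_all add: G_def)
        also have "\<dots> = (\<Sum>S\<in>UNIV. kernel_prob S * (\<integral>w. indicator B (F S (U w)) \<partial>P))"
        proof (rule sample(2)[OF _ _ j])
          show m: "(\<lambda>x. indicator B (F S x) :: real) \<in> borel_measurable N" for S
            using measurable_compose[OF F, of "indicator B :: real \<Rightarrow> real" borel S] by simp
          show "integrable P (\<lambda>w. indicator B (F S (U w)) :: real)" for S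
            using measurable_compose[OF assms(3) m[of S]]
            by (intro P.integrable_const_bound[where B=1]) (auto simp: indicator_def)
        qed
        finally show ?thesis .
      qed
      interpret D1: prob_space "distr M borel (\<lambda>\<omega>. G (z i \<omega>, u i \<omega>))"
        by (rule M.prob_space_distr[OF Gm[OF i]])
      interpret D2: prob_space "distr M borel (\<lambda>\<omega>. G (z 1 \<omega>, u 1 \<omega>))"
        by (rule M.prob_space_distr[OF Gm]) simp
      show "emeasure (distr M borel (\<lambda>\<omega>. G (z i \<omega>, u i \<omega>))) B
          = emeasure (distr M borel (\<lambda>\<omega>. G (z 1 \<omega>, u 1 \<omega>))) B"
        unfolding D1.emeasure_eq_measure D2.emeasure_eq_measure mB[OF i] mB[OF order_refl] ..
    qed simp
    have "AE \<omega> in M. (\<lambda>n. (\<Sum>m=1..n. G (z m \<omega>, u m \<omega>)) / real n)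
        \<longlonglongrightarrow> M.expectation (\<lambda>\<omega>. G (z 1 \<omega>, u 1 \<omega>))"
    proof (rule M.strong_law_of_large_numbers)
      show "M.indep_vars (\<lambda>_. borel) (\<lambda>i \<omega>. G (z i \<omega>, u i \<omega>)) {1..}"
        by (rule M.indep_vars_compose2[OF assms(12)]) (rule G)
      show "distr M borel (\<lambda>\<omega>. G (z i \<omega>, u i \<omega>)) = distr M borel (\<lambda>\<omega>. G (z 1 \<omega>, u 1 \<omega>))"
        if "1 \<le> i" for i
        by (rule dG[OF that])
      show "integrable M (\<lambda>\<omega>. G (z 1 \<omega>, u 1 \<omega>))"
        unfolding G_def using sample(1)[of F 1, OF F int] by simp
    qed
    then show ?thesis
      unfolding G_def fst_conv snd_conv using sample(2)[of F 1, OF F int] by simp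
  qed
  let ?b = "kernel_target P U V"
  let ?bu = "\<lambda>n \<omega>. b_tilde_unbiased P U V (\<lambda>i. z i \<omega>) (\<lambda>i. u i \<omega>) n"
  have limA: "AE \<omega> in M. A_hat (\<lambda>i. z i \<omega>) \<longlonglongrightarrow> kernel_second_moment"
  proof -
    have "AE \<omega> in M. \<forall>i j. (\<lambda>n. A_hat (\<lambda>i. z i \<omega>) n $ i $ j) \<longlonglongrightarrow> kernel_second_moment $ i $ j"
    proof (intro eventually_all_finite)
      fix i j
      \<comment> \<open>This function ignores the sample of \<open>U\<close>, so the inner integral
        over \<open>P\<close> returns it unchanged.\<close>
      let ?F = "\<lambda>(S :: 'd set) (x :: 'u). (if j \<in> S then 1 else 0 :: real) * (if i \<in> S then 1 else 0)"
      have "(\<integral>w. ?F S (U w) \<partial>P) = ?F S undefined" for S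
        by (simp add: P.prob_space)
      moreover have "AE \<omega> in M. (\<lambda>n. (\<Sum>m=1..n. ?F (z m \<omega>) (u m \<omega>)) / real n)
          \<longlonglongrightarrow> (\<Sum>S\<in>UNIV. kernel_prob S * (\<integral>w. ?F S (U w) \<partial>P))"
        by (rule slln[of ?F]) simp_all
      ultimately show "AE \<omega> in M. (\<lambda>n. A_hat (\<lambda>i. z i \<omega>) n $ i $ j) \<longlonglongrightarrow> kernel_second_moment $ i $ j"
        by (simp only: A_hat_nth kernel_second_moment_nth mult.assoc)
    qed
    then show ?thesis by eventually_elim (intro vec_tendstoI, simp)
  qed
  have limb: "AE \<omega> in M. b_tilde P U V (\<lambda>i. z i \<omega>) (\<lambda>i. u i \<omega>) \<longlonglongrightarrow> ?b"
  proof -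
    have "AE \<omega> in M. \<forall>i. (\<lambda>n. b_tilde P U V (\<lambda>i. z i \<omega>) (\<lambda>i. u i \<omega>) n $ i) \<longlonglongrightarrow> ?b $ i"
    proof (intro eventually_all_finite)
      fix i
      let ?F = "\<lambda>S x. (V S x - game_mean P U V {}) * (if i \<in> S then 1 else 0)"
      have "(\<integral>w. (V S (U w) - game_mean P U V {}) * (if i \<in> S then 1 else 0) \<partial>P)
          = (game_mean P U V S - game_mean P U V {}) * (if i \<in> S then 1 else 0)" for S
        using assms(5)[of S] by (simp add: game_mean_def P.prob_space)
      moreover have "AE \<omega> in M. (\<lambda>n. (\<Sum>m=1..n. ?F (z m \<omega>) (u m \<omega>)) / real n)
          \<longlonglongrightarrow> (\<Sum>S\<in>UNIV. kernel_prob S * (\<integral>w. ?F S (U w) \<partial>P))"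
        using assms(4,5) by (intro slln[of ?F]) simp_all
      ultimately show "AE \<omega> in M. (\<lambda>n. b_tilde P U V (\<lambda>i. z i \<omega>) (\<lambda>i. u i \<omega>) n $ i) \<longlonglongrightarrow> ?b $ i"
        by (simp only: b_tilde_nth kernel_target_nth)
    qed
    then show ?thesis by eventually_elim (intro vec_tendstoI, simp)
  qed
  have EV: "(\<integral>w. V S (U w) * (if i \<in> S then 1 else 0) \<partial>P) = game_mean P U V S * (if i \<in> S then 1 else 0)" for S i
    by (simp add: game_mean_def)
  have limbu: "AE \<omega> in M. (\<lambda>n. ?bu n \<omega>) \<longlonglongrightarrow> ?b"
  proof -
    have "AE \<omega> in M. \<forall>i. (\<lambda>n. ?bu n \<omega> $ i) \<longlonglongrightarrow> ?b $ i"
    proof (intro eventually_all_finite)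
      fix i
      have "AE \<omega> in M. (\<lambda>n. (\<Sum>m=1..n. V (z m \<omega>) (u m \<omega>) * (if i \<in> z m \<omega> then 1 else 0)) / real n)
          \<longlonglongrightarrow> (\<Sum>S\<in>UNIV. kernel_prob S * (game_mean P U V S * (if i \<in> S then 1 else 0)))"
        unfolding EV[symmetric] using assms(4,5)
        by (intro slln[of "\<lambda>S x. V S x * (if i \<in> S then 1 else 0)"]) simp_all
      then show "AE \<omega> in M. (\<lambda>n. ?bu n \<omega> $ i) \<longlonglongrightarrow> ?b $ i"
        unfolding b_tilde_unbiased_nth kernel_target_nth'
        by eventually_elim (intro tendsto_diff tendsto_const)
    qed
    then show ?thesis by eventually_elim (intro vec_tendstoI, simp)
  qed
  have inv: "invertible (kernel_second_moment :: real ^ 'd ^ 'd)"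
    by (rule kernel_second_moment_invertible[OF d])
  have q: "(1 :: real ^ 'd) \<bullet> (matrix_inv kernel_second_moment *v 1) \<noteq> 0"
    using one_inverse_second_moment_one_pos[OF d] by simp
  have target: "constrained_solution P U V kernel_second_moment ?b = shapley_values P U V"
    by (rule constrained_solution_eq_shapley_values[OF d]) (rule assms(5))
  have consistent: "AE \<omega> in M.
      (\<lambda>n. stochastic_kernelshap P U V (\<lambda>i. z i \<omega>) (\<lambda>i. u i \<omega>) n) \<longlonglongrightarrow> shapley_values P U V"
    using limA limb
  proof eventually_elim
    case (elim \<omega>)
    \<comment> \<open>Determinants converge to a nonzero limit along this path, so the conventional
      value 0 occurs for at most finitely many \<open>n\<close>.\<close>
    have "\<forall>\<^sub>F n in sequentially. invertible (A_hat (\<lambda>i. z i \<omega>) n)"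
      unfolding invertible_det_nz
      by (rule tendsto_imp_eventually_ne[OF tendsto_det[OF elim(1)]]) (use inv invertible_det_nz in blast)
    then have "\<forall>\<^sub>F n in sequentially.
        constrained_solution P U V (A_hat (\<lambda>i. z i \<omega>) n) (b_tilde P U V (\<lambda>i. z i \<omega>) (\<lambda>i. u i \<omega>) n)
        = stochastic_kernelshap P U V (\<lambda>i. z i \<omega>) (\<lambda>i. u i \<omega>) n"
      by eventually_elim (simp add: stochastic_kernelshap_def)
    with tendsto_constrained_solution[OF elim inv q] show ?case
      unfolding target[symmetric] by (rule Lim_transform_eventually)
  qed
  have unbiased: "integrable M (\<lambda>\<omega>. stochastic_unbiased_kernelshap P U V (\<lambda>i. z i \<omega>) (\<lambda>i. u i \<omega>) n) \<and>
      (\<integral>\<omega>. stochastic_unbiased_kernelshap P U V (\<lambda>i. z i \<omega>) (\<lambda>i. u i \<omega>) n \<partial>M) = shapley_values P U V"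
    if n: "n \<ge> 1" for n
  proof -
    have summand: "integrable M (\<lambda>\<omega>. V (z m \<omega>) (u m \<omega>) * (if i \<in> z m \<omega> then 1 else 0))"
      "M.expectation (\<lambda>\<omega>. V (z m \<omega>) (u m \<omega>) * (if i \<in> z m \<omega> then 1 else 0))
        = (\<Sum>S\<in>UNIV. kernel_prob S * (game_mean P U V S * (if i \<in> S then 1 else 0)))"
      if "m \<ge> 1" for i m
      using sample[of "\<lambda>S x. V S x * (if i \<in> S then 1 else 0)" m] assms(4,5) that
      unfolding EV by simp_all
    have int_i: "integrable M (\<lambda>\<omega>. ?bu n \<omega> $ i)" for i
      unfolding b_tilde_unbiased_nth using summand(1)
      by (intro Bochner_Integration.integrable_diff integrable_divide_zero
          Bochner_Integration.integrable_sum) auto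
    have int: "integrable M (?bu n)" by (rule integrable_vec_componentwise) (rule int_i)
    have mean: "M.expectation (?bu n) = ?b"
    proof (rule vec_eq_iff[THEN iffD2, rule_format])
      fix i
      have "M.expectation (?bu n) $ i = M.expectation (\<lambda>\<omega>. ?bu n \<omega> $ i)"
        by (rule integral_bounded_linear[OF bounded_linear_vec_nth int, symmetric])
      also have "\<dots> = M.expectation (\<lambda>\<omega>. (\<Sum>m=1..n. V (z m \<omega>) (u m \<omega>) * (if i \<in> z m \<omega> then 1 else 0)) / real n)
          - game_mean P U V {} * kernel_mean $ i"
        unfolding b_tilde_unbiased_nth using summand(1)
        by (subst Bochner_Integration.integral_diff)
          (auto simp: M.prob_space intro!: integrable_divide_zero Bochner_Integration.integrable_sum)
      also have "M.expectation (\<lambda>\<omega>. (\<Sum>m=1..n. V (z m \<omega>) (u m \<omega>) * (if i \<in> z m \<omega> then 1 else 0)) / real n)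
          = (\<Sum>m=1..n. M.expectation (\<lambda>\<omega>. V (z m \<omega>) (u m \<omega>) * (if i \<in> z m \<omega> then 1 else 0))) / real n"
        unfolding integral_divide_zero using summand(1)
        by (subst Bochner_Integration.integral_sum) auto
      also have "\<dots> = (\<Sum>S\<in>UNIV. kernel_prob S * (game_mean P U V S * (if i \<in> S then 1 else 0)))"
        using n summand(2)[of _ i] by simp
      finally show "M.expectation (?bu n) $ i = ?b $ i" unfolding kernel_target_nth' .
    qed
    obtain L k where L: "bounded_linear L"
      and aff: "\<And>c. constrained_solution P U V kernel_second_moment c = L c + k"
      using constrained_solution_affine[of P U V kernel_second_moment] by blast
    have "integrable M (\<lambda>\<omega>. L (?bu n \<omega>))" by (rule integrable_bounded_linear[OF L int])
    moreover have "M.expectation (\<lambda>\<omega>. L (?bu n \<omega>)) = L ?b"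
      unfolding mean[symmetric] by (rule integral_bounded_linear[OF L int])
    ultimately show ?thesis
      unfolding stochastic_unbiased_kernelshap_def target[symmetric] aff
      by (simp add: M.prob_space)
  qed
  have "AE \<omega> in M. (\<lambda>n. stochastic_unbiased_kernelshap P U V (\<lambda>i. z i \<omega>) (\<lambda>i. u i \<omega>) n)
      \<longlonglongrightarrow> shapley_values P U V"
    using limbu unfolding stochastic_unbiased_kernelshap_def target[symmetric]
    by eventually_elim (rule tendsto_constrained_solution[OF tendsto_const _ inv q])
  with consistent unbiased show ?thesis by blast
qed

end
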